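(* (i) For each odd integer $D\geq 1$, every $\left(\frac{4D+3}{2D+2},\frac{1}{2(D+1)}\right)$-sparse multigraph $G$ has a $(D,\mathrm{F})_e$-coloring. (ii) For each even integer $D\geq 2$, every $\left(\frac{4D+1}{2D+1},\frac{1}{2D+1}\right)$-sparse multigraph $G$ has a $(D,\mathrm{F})_e$-coloring. Here a $(D,\mathrm{F})_e$-coloring of $G$ is a partition $(M,F)$ of $V(G)$ such that $G[M]$ is a forest in which every connected component has at most $D$ edges, and $G[F]$ is a forest.
   Context: All multigraphs are loopless. For $a>0$ and real $b$, a multigraph $H$ is $(a,b)$-sparse if it is loopless and for every $A\subseteq V(H)$ with $|A|\geq 2$, the induced subgraph $H[A]$ has at most $a|A|+b$ edges (counted with multiplicity). A forest is an acyclic multigraph; a pair of parallel edges counts as a cycle, so forests have no multiple edges. *)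

theory Defs
  imports Complex_Main
begin

text \<open>
  An undirected multigraph: every edge \<open>e\<close> is an object of its own, joining the vertices in
  \<open>ends G e\<close>. A loop at \<open>v\<close> is an edge with \<open>ends G e = {v}\<close>; distinct edges with the
  same set of ends are parallel.
\<close>

record ('v, 'e) multigraph =
  verts :: "'v set"
  edges :: "'e set"
  ends :: "'e \<Rightarrow> 'v set"

definition finite_multigraph :: "('v, 'e) multigraph \<Rightarrow> bool" where
  "finite_multigraph G \<longleftrightarrow>
     finite (verts G) \<and> finite (edges G) \<and>
     (\<forall>e\<in>edges G. ends G e \<subseteq> verts G \<and> card (ends G e) \<in> {1, 2})"

definition loopless :: "('v, 'e) multigraph \<Rightarrow> bool" where
  "loopless G \<longleftrightarrow> (\<forall>e\<in>edges G. card (ends G e) \<noteq> 1)"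

definition induced_subgraph :: "('v, 'e) multigraph \<Rightarrow> 'v set \<Rightarrow> ('v, 'e) multigraph" where
  "induced_subgraph G A =
     \<lparr>verts = A, edges = {e \<in> edges G. ends G e \<subseteq> A}, ends = ends G\<rparr>"

definition sparse :: "real \<Rightarrow> real \<Rightarrow> ('v, 'e) multigraph \<Rightarrow> bool" where
  "sparse a b G \<longleftrightarrow>
     loopless G \<and>
     (\<forall>A. A \<subseteq> verts G \<and> card A \<ge> 2 \<longrightarrow>
        real (card (edges (induced_subgraph G A))) \<le> a * real (card A) + b)"

text \<open>
  The cycle \<open>vs ! 0, es ! 0, vs ! 1, es ! 1, \<dots>\<close> closing up at \<open>vs ! 0\<close>. Length 1 is a loop and
  length 2 is a pair of parallel edges.
\<close>

definition is_cycle :: "('v, 'e) multigraph \<Rightarrow> 'v list \<Rightarrow> 'e list \<Rightarrow> bool" where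
  "is_cycle G vs es \<longleftrightarrow>
     vs \<noteq> [] \<and> length es = length vs \<and>
     distinct vs \<and> distinct es \<and>
     set vs \<subseteq> verts G \<and> set es \<subseteq> edges G \<and>
     (\<forall>i<length vs. ends G (es ! i) = {vs ! i, vs ! (Suc i mod length vs)})"

definition forest :: "('v, 'e) multigraph \<Rightarrow> bool" where
  "forest G \<longleftrightarrow> \<not> (\<exists>vs es. is_cycle G vs es)"

definition adjacency :: "('v, 'e) multigraph \<Rightarrow> ('v \<times> 'v) set" where
  "adjacency G = {(u, v). \<exists>e\<in>edges G. ends G e = {u, v}}"

definition connected_components :: "('v, 'e) multigraph \<Rightarrow> ('v, 'e) multigraph set" where
  "connected_components G =
     (\<lambda>v. induced_subgraph G {u \<in> verts G. (v, u) \<in> (adjacency G)\<^sup>*}) ` verts G"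

text \<open>As usual for colorings, either of the two classes may be empty.\<close>

definition DF_e_coloring :: "nat \<Rightarrow> ('v, 'e) multigraph \<Rightarrow> 'v set \<Rightarrow> 'v set \<Rightarrow> bool" where
  "DF_e_coloring D G M F \<longleftrightarrow>
     M \<union> F = verts G \<and> M \<inter> F = {} \<and>
     forest (induced_subgraph G M) \<and>
     (\<forall>C\<in>connected_components (induced_subgraph G M). card (edges C) \<le> D) \<and>
     forest (induced_subgraph G F)"

end

theory Submission
  imports Defs
begin

text \<open>
  Give every vertex a weight, counted as additional edges of its component in the class \<open>M\<close>; weight
  greater than \<open>D\<close> forces a vertex into \<open>F\<close>. With \<open>K = 2D + 1\<close> or \<open>K = 2D + 2\<close> (\<open>D\<close> even or odd), an
  edge lowers the potential by \<open>K\<close>, a vertex of weight 0 raises it by \<open>2K - 1\<close>, and a unit of weight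
  costs about 2. The sparsity condition says that all vertex sets have potential at least \<open>-1\<close>.

  In a minimal counterexample every proper set \<open>A\<close> of at least two vertices has potential at least
  \<open>K\<close>: otherwise take such an \<open>A\<close> of minimal potential, colour it, contract its \<open>F\<close>-part to one forced
  vertex, force the outer neighbours of its \<open>M\<close>-part, and colour the rest. By this gap a vertex of
  degree 3 and small weight may be deleted while the weights of its neighbours grow, so that
  it can be put back. The remaining vertices have total charge (twice the potential minus \<open>K\<close> times the
  degree) too small, unless \<open>D\<close> is odd and the whole graph has potential exactly \<open>-1\<close>. In that
  case the set \<open>P\<close> of vertices of positive charge is independent, and counting charges shows that
  its complement \<open>N\<close> induces almost a matching; moving at most three vertices of \<open>N\<close> to
  the side of \<open>P\<close> gives a colouring.
\<close>

section \<open>Edge counts of multigraphs given by multiplicities\<close>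

text \<open>An edge costs \<open>kk D\<close> because that is the price of forcing a vertex of
  weight 0: \<open>D + 1\<close> units at 2 each for odd \<open>D\<close>, one of them at 1 for even
  \<open>D\<close>. So an edge deleted towards a coloured part pays for any change of weight at its
  outer end, and a forced vertex, worth \<open>kk D - 1\<close>, is worth at least as much as any
  set of potential below \<open>kk D\<close> that is contracted to it. One situation stays unpaid:
  all edges leave from the \<open>M\<close>-part, and the whole complement falls short by up to the
  potential of the coloured set. There one edge must be allowed inside \<open>M\<close>, and the
  budget \<open>D\<close> is divided between its ends in advance; the price of single units is made
  for this division.

  A total potential of -1 means total charge -2. For odd \<open>D\<close>, degree 3 and weight
  \<open>D div 2\<close> give charge 2, and such a vertex escapes deletion only because the whole
  graph misses the required potential by one. Hence charges alone give no contradiction, but they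
  leave so little freedom that the rest can be coloured by hand.\<close>

definition mgraph :: "('v \<Rightarrow> 'v \<Rightarrow> nat) \<Rightarrow> bool" where
  "mgraph m \<longleftrightarrow> (\<forall>x y. m x y = m y x) \<and> (\<forall>x. m x x = 0)"

definition dg :: "('v \<Rightarrow> 'v \<Rightarrow> nat) \<Rightarrow> 'v \<Rightarrow> 'v set \<Rightarrow> nat" where
  "dg m v A = (\<Sum>y\<in>A. m v y)"

definition cr :: "('v \<Rightarrow> 'v \<Rightarrow> nat) \<Rightarrow> 'v set \<Rightarrow> 'v set \<Rightarrow> nat" where
  "cr m A B = (\<Sum>x\<in>A. dg m x B)"

text \<open>\<open>cr m A A\<close> meets every inner edge from both ends, hence the
  halving.\<close>

definition ne :: "('v \<Rightarrow> 'v \<Rightarrow> nat) \<Rightarrow> 'v set \<Rightarrow> nat" where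
  "ne m A = cr m A A div 2"

lemma mgraph_sym: "mgraph m \<Longrightarrow> m x y = m y x"
  and mgraph_irrefl: "mgraph m \<Longrightarrow> m x x = 0"
  by (auto simp: mgraph_def)

lemma dg_empty [simp]: "dg m v {} = 0"
  by (simp add: dg_def)

lemma dg_insert: "finite A \<Longrightarrow> x \<notin> A \<Longrightarrow> dg m v (insert x A) = m v x + dg m v A"
  by (simp add: dg_def)

lemma dg_Un: "finite A \<Longrightarrow> finite B \<Longrightarrow> A \<inter> B = {} \<Longrightarrow> dg m v (A \<union> B) = dg m v A + dg m v B"
  by (simp add: dg_def sum.union_disjoint)

lemma dg_mono: "finite B \<Longrightarrow> A \<subseteq> B \<Longrightarrow> dg m v A \<le> dg m v B"
  by (simp add: dg_def sum_mono2)

lemma dg_ge: "finite A \<Longrightarrow> x \<in> A \<Longrightarrow> m v x \<le> dg m v A"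
  by (simp add: dg_def member_le_sum)

lemma dg_eq_0: "finite A \<Longrightarrow> dg m v A = 0 \<longleftrightarrow> (\<forall>x\<in>A. m v x = 0)"
  by (simp add: dg_def)

lemma dg_remove: "finite A \<Longrightarrow> x \<in> A \<Longrightarrow> dg m v A = m v x + dg m v (A - {x})"
  by (simp add: dg_def sum.remove)

lemma dg_cong: "(\<And>y. y \<in> A \<Longrightarrow> m v y = m' v y) \<Longrightarrow> dg m v A = dg m' v A"
  by (simp add: dg_def)

lemma cr_sym: "mgraph m \<Longrightarrow> cr m A B = cr m B A"
  unfolding cr_def dg_def by (subst sum.swap) (simp add: mgraph_sym)

lemma cr_empty [simp]: "cr m {} A = 0" "cr m A {} = 0"
  by (auto simp: cr_def)

lemma cr_insert: "finite A \<Longrightarrow> x \<notin> A \<Longrightarrow> cr m (insert x A) B = dg m x B + cr m A B"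
  by (simp add: cr_def)

lemma cr_insert2: "mgraph m \<Longrightarrow> finite B \<Longrightarrow> x \<notin> B \<Longrightarrow> cr m A (insert x B) = dg m x A + cr m A B"
  by (simp add: cr_sym[of m A] cr_insert)

lemma cr_Un: "finite A \<Longrightarrow> finite B \<Longrightarrow> A \<inter> B = {} \<Longrightarrow> cr m (A \<union> B) C = cr m A C + cr m B C"
  by (simp add: cr_def sum.union_disjoint)

lemma cr_Un2: "mgraph m \<Longrightarrow> finite A \<Longrightarrow> finite B \<Longrightarrow> A \<inter> B = {} \<Longrightarrow>
    cr m C (A \<union> B) = cr m C A + cr m C B"
  by (simp add: cr_sym[of m C] cr_Un)

lemma cr_mono: "finite A' \<Longrightarrow> finite B' \<Longrightarrow> A \<subseteq> A' \<Longrightarrow> B \<subseteq> B' \<Longrightarrow> cr m A B \<le> cr m A' B'"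
  unfolding cr_def
  by (rule order_trans[OF sum_mono sum_mono2]) (auto intro: dg_mono)

lemma cr_eq_0: "finite A \<Longrightarrow> finite B \<Longrightarrow> cr m A B = 0 \<longleftrightarrow> (\<forall>x\<in>A. \<forall>y\<in>B. m x y = 0)"
  by (simp add: cr_def dg_eq_0)

lemma even_cr_self:
  assumes "mgraph m" "finite A"
  shows "even (cr m A A)"
  using assms(2)
proof (induction A)
  case (insert x F)
  then show ?case
    using assms(1) by (simp add: cr_insert cr_insert2 dg_insert mgraph_irrefl)
qed simp

lemma two_ne: "mgraph m \<Longrightarrow> finite A \<Longrightarrow> 2 * ne m A = cr m A A"
  by (simp add: ne_def even_cr_self)

lemma ne_empty [simp]: "ne m {} = 0"
  by (simp add: ne_def)

lemma ne_Un:
  assumes "mgraph m" "finite A" "finite B" "A \<inter> B = {}"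
  shows "ne m (A \<union> B) = ne m A + ne m B + cr m A B"
proof -
  have "2 * ne m (A \<union> B) = cr m A A + cr m A B + (cr m B A + cr m B B)"
    using assms by (simp add: two_ne cr_Un cr_Un2)
  then show ?thesis
    using assms two_ne[of m A] two_ne[of m B] cr_sym[of m A B] by simp
qed

lemma ne_insert:
  assumes "mgraph m" "finite A" "v \<notin> A"
  shows "ne m (insert v A) = ne m A + dg m v A"
  using ne_Un[of m "{v}" A] assms
  by (simp add: cr_def ne_def dg_def mgraph_irrefl)

lemma ne_singleton [simp]: "mgraph m \<Longrightarrow> ne m {v} = 0"
  by (simp add: ne_insert)

lemma ne_cong: "(\<And>x y. x \<in> A \<Longrightarrow> y \<in> A \<Longrightarrow> m x y = m' x y) \<Longrightarrow> ne m A = ne m' A"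
  unfolding ne_def cr_def dg_def by simp

section \<open>Forests and weighted forests\<close>

text \<open>Acyclicity as an edge count: the vertex set of a cycle spans at least as many edges as
  vertices. In this form gluing, contracting and reinserting become sums of edge numbers.\<close>

definition forest_on :: "('v \<Rightarrow> 'v \<Rightarrow> nat) \<Rightarrow> 'v set \<Rightarrow> bool" where
  "forest_on m F \<longleftrightarrow> (\<forall>B\<subseteq>F. B \<noteq> {} \<longrightarrow> ne m B < card B)"

text \<open>
  In a forest, a nonempty set \<open>B\<close> spans a tree iff it has \<open>card B - 1\<close> inner edges; the weight of
  a vertex counts as additional edges of its component.
\<close>

definition bounded_forest_on :: "nat \<Rightarrow> ('v \<Rightarrow> 'v \<Rightarrow> nat) \<Rightarrow> ('v \<Rightarrow> nat) \<Rightarrow> 'v set \<Rightarrow> bool" where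
  "bounded_forest_on D m w M \<longleftrightarrow> forest_on m M \<and>
     (\<forall>B\<subseteq>M. Suc (ne m B) = card B \<longrightarrow> ne m B + sum w B \<le> D)"

definition colorable :: "nat \<Rightarrow> ('v \<Rightarrow> 'v \<Rightarrow> nat) \<Rightarrow> ('v \<Rightarrow> nat) \<Rightarrow> 'v set \<Rightarrow> bool" where
  "colorable D m w V \<longleftrightarrow>
     (\<exists>M F. M \<union> F = V \<and> M \<inter> F = {} \<and> bounded_forest_on D m w M \<and> forest_on m F)"

lemma forest_onD: "forest_on m F \<Longrightarrow> B \<subseteq> F \<Longrightarrow> B \<noteq> {} \<Longrightarrow> ne m B < card B"
  by (simp add: forest_on_def)

lemma forest_on_empty [simp]: "forest_on m {}"
  by (simp add: forest_on_def)

lemma forest_on_mono: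
  assumes "forest_on m' F" "\<And>B. B \<subseteq> F \<Longrightarrow> ne m B \<le> ne m' B"
  shows "forest_on m F"
  using assms unfolding forest_on_def by (meson le_less_trans)

lemma bounded_forest_on_forest: "bounded_forest_on D m w M \<Longrightarrow> forest_on m M"
  by (simp add: bounded_forest_on_def)

lemma bounded_forest_on_tree:
  "bounded_forest_on D m w M \<Longrightarrow> B \<subseteq> M \<Longrightarrow> Suc (ne m B) = card B \<Longrightarrow> ne m B + sum w B \<le> D"
  by (simp add: bounded_forest_on_def)

lemma bounded_forest_on_empty [simp]: "bounded_forest_on D m w {}"
  by (auto simp: bounded_forest_on_def)

lemma bounded_forest_on_weight:
  assumes "mgraph m" "bounded_forest_on D m w M" "v \<in> M"
  shows "w v \<le> D"
proof -
  have "Suc (ne m {v}) = card {v}" using assms(1) by simp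
  then have "ne m {v} + sum w {v} \<le> D"
    using assms(2,3) unfolding bounded_forest_on_def by blast
  then show ?thesis by simp
qed

lemma bounded_forest_on_mono:
  assumes "bounded_forest_on D m' w' M" "\<And>B. B \<subseteq> M \<Longrightarrow> ne m B \<le> ne m' B"
    and "\<And>x. x \<in> M \<Longrightarrow> w x \<le> w' x"
  shows "bounded_forest_on D m w M"
  unfolding bounded_forest_on_def
proof (intro conjI allI impI)
  show "forest_on m M"
    using forest_on_mono[OF bounded_forest_on_forest[OF assms(1)] assms(2)] .
next
  fix B assume B: "B \<subseteq> M" "Suc (ne m B) = card B"
  then have "B \<noteq> {}" by auto
  then have "ne m' B < card B"
    using forest_onD[OF bounded_forest_on_forest[OF assms(1)] B(1)] by simp
  \<comment> \<open>\<open>B\<close> is a tree for \<open>m\<close> and still acyclic for the larger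
    \<open>m'\<close>, so \<open>m'\<close> has no further edge inside it.\<close>
  then have eq: "ne m' B = ne m B"
    using B assms(2)[of B] by simp
  then have "ne m' B + sum w' B \<le> D"
    using bounded_forest_on_tree[OF assms(1) B(1)] B(2) by simp
  moreover have "sum w B \<le> sum w' B"
    using B assms(3) by (intro sum_mono) auto
  ultimately show "ne m B + sum w B \<le> D"
    using eq by simp
qed

section \<open>Inserting vertices and gluing coloured parts\<close>

lemma forest_on_insert:
  assumes m: "mgraph m" and F: "finite F" "forest_on m F" and "v \<notin> F" "dg m v F \<le> 1"
  shows "forest_on m (insert v F)"
  unfolding forest_on_def
proof (intro allI impI)
  fix B assume B: "B \<subseteq> insert v F" "B \<noteq> {}"
  show "ne m B < card B"
  proof (cases "v \<in> B")
    case True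
    define B' where "B' = B - {v}"
    have B': "B = insert v B'" "v \<notin> B'" "B' \<subseteq> F" "finite B'"
      using True B F by (auto simp: B'_def intro: finite_subset)
    have "dg m v B' \<le> 1"
      using dg_mono[OF F(1) B'(3), of m v] assms(5) by simp
    moreover have "B' = {} \<or> ne m B' < card B'"
      using F B' forest_onD by metis
    ultimately show ?thesis
      using B' by (auto simp: ne_insert[OF m])
  next
    case False
    then show ?thesis using B F forest_onD[of m F B] by blast
  qed
qed

lemma forest_on_Un:
  assumes m: "mgraph m" and fin: "finite F1" "finite F2" and disj: "F1 \<inter> F2 = {}"
    and F: "forest_on m F1" "forest_on m F2"
    and cross: "\<And>x y. x \<in> F1 \<Longrightarrow> y \<in> F2 \<Longrightarrow> m x y = 0"
  shows "forest_on m (F1 \<union> F2)"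
  unfolding forest_on_def
proof (intro allI impI)
  fix B assume B: "B \<subseteq> F1 \<union> F2" "B \<noteq> {}"
  define B1 B2 where "B1 = B \<inter> F1" and "B2 = B \<inter> F2"
  have BU: "B = B1 \<union> B2" "B1 \<inter> B2 = {}" and s: "B1 \<subseteq> F1" "B2 \<subseteq> F2"
    using B disj by (auto simp: B1_def B2_def)
  have f: "finite B1" "finite B2" using s fin finite_subset by auto
  have "cr m B1 B2 = 0"
    using cross s f by (subst cr_eq_0) blast+
  then have "ne m B = ne m B1 + ne m B2" "card B = card B1 + card B2"
    using BU f by (simp_all add: ne_Un[OF m] card_Un_disjoint)
  moreover have "B1 \<noteq> {} \<Longrightarrow> ne m B1 < card B1" "B2 \<noteq> {} \<Longrightarrow> ne m B2 < card B2"
    using forest_onD[OF F(1) s(1)] forest_onD[OF F(2) s(2)] by auto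
  ultimately show "ne m B < card B"
    using B BU by (cases "B1 = {}"; cases "B2 = {}") auto
qed

text \<open>The weights \<open>w'\<close> reserve room in advance: a neighbour of \<open>v\<close>
  carries \<open>w v + 1\<close> extra units, the weight of \<open>v\<close> plus the new edge, so a
  tree through \<open>v\<close> is paid for by the same tree without \<open>v\<close>.\<close>

lemma bounded_forest_on_insert:
  assumes m: "mgraph m" and M: "finite M" "bounded_forest_on D m w' M"
    and v: "v \<notin> M" "dg m v M \<le> 1" "w v \<le> D"
    and w: "\<And>x. x \<in> M \<Longrightarrow> w x + m v x * (w v + 1) \<le> w' x"
  shows "bounded_forest_on D m w (insert v M)"
  unfolding bounded_forest_on_def
proof (intro conjI allI impI)
  show "forest_on m (insert v M)"
    using forest_on_insert[OF m M(1) _ v(1,2)] M by (simp add: bounded_forest_on_def)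
next
  fix B assume B: "B \<subseteq> insert v M" "Suc (ne m B) = card B"
  show "ne m B + sum w B \<le> D"
  proof (cases "v \<in> B")
    case True
    define B' where "B' = B - {v}"
    have B': "B = insert v B'" "v \<notin> B'" "B' \<subseteq> M" "finite B'"
      using True B M by (auto simp: B'_def intro: finite_subset)
    have dg1: "dg m v B' \<le> 1"
      using dg_mono[OF M(1) B'(3), of m v] v by simp
    show ?thesis
    proof (cases "B' = {}")
      case True
      then show ?thesis using B' v m by simp
    next
      case False
      then have "ne m B' < card B'"
        using forest_onD[OF bounded_forest_on_forest[OF M(2)] B'(3)] by simp
      moreover have "Suc (ne m B' + dg m v B') = Suc (card B')"
        using B B' by (simp add: ne_insert[OF m])
      ultimately have tree: "Suc (ne m B') = card B'" "dg m v B' = 1"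
        using dg1 by linarith+
      then have "ne m B' + sum w' B' \<le> D"
        using bounded_forest_on_tree[OF M(2) B'(3)] by simp
      moreover have "sum w B' + dg m v B' * (w v + 1) \<le> sum w' B'"
        using w B'(3) unfolding dg_def sum_distrib_right sum.distrib[symmetric]
        by (intro sum_mono) auto
      ultimately show ?thesis
        using B' tree by (simp add: ne_insert[OF m])
    qed
  next
    case False
    then have "B \<subseteq> M" using B by blast
    then have "ne m B + sum w' B \<le> D"
      using bounded_forest_on_tree[OF M(2)] B by simp
    moreover have "sum w B \<le> sum w' B"
      using w \<open>B \<subseteq> M\<close> by (intro sum_mono) (meson add_leD1 subsetD)
    ultimately show ?thesis by simp
  qed
qed

text \<open>The extra \<open>t\<close> at \<open>a\<close> limits its tree to \<open>D - t\<close>,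
  the extra \<open>D - t + 1\<close> at \<open>u\<close> limits the other tree to
  \<open>t - 1\<close>; with the edge between them the total is \<open>D\<close>. As
  \<open>au\<close> is conditional, gluing without any cross edge is covered too.\<close>

lemma bounded_forest_on_Un:
  assumes m: "mgraph m" and fin: "finite M1" "finite M2" and disj: "M1 \<inter> M2 = {}"
    and M1: "bounded_forest_on D m w1 M1" and M2: "bounded_forest_on D m w2 M2"
    and cross: "\<And>x y. x \<in> M1 \<Longrightarrow> y \<in> M2 \<Longrightarrow> (x, y) \<noteq> (a, u) \<Longrightarrow> m x y = 0"
    and au: "a \<in> M1 \<Longrightarrow> u \<in> M2 \<Longrightarrow> m a u \<noteq> 0 \<Longrightarrow>
      m a u = 1 \<and> t \<le> D \<and> w a + t \<le> w1 a \<and> w u + (D - t) + 1 \<le> w2 u"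
    and w1: "\<And>x. x \<in> M1 \<Longrightarrow> w x \<le> w1 x" and w2: "\<And>x. x \<in> M2 \<Longrightarrow> w x \<le> w2 x"
  shows "bounded_forest_on D m w (M1 \<union> M2)"
proof -
  have *: "ne m B < card B \<and> (Suc (ne m B) = card B \<longrightarrow> ne m B + sum w B \<le> D)"
    if B: "B \<subseteq> M1 \<union> M2" "B \<noteq> {}" for B
  proof -
    define B1 B2 where "B1 = B \<inter> M1" and "B2 = B \<inter> M2"
    have BU: "B = B1 \<union> B2" and d: "B1 \<inter> B2 = {}" and s: "B1 \<subseteq> M1" "B2 \<subseteq> M2"
      using B disj by (auto simp: B1_def B2_def)
    have f: "finite B1" "finite B2" using s fin finite_subset by auto
    have e: "ne m B = ne m B1 + ne m B2 + cr m B1 B2"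
      unfolding BU by (rule ne_Un[OF m f d])
    have c: "card B = card B1 + card B2" and ws: "sum w B = sum w B1 + sum w B2"
      unfolding BU using f d by (auto simp: card_Un_disjoint sum.union_disjoint)
    have f1: "B1 \<noteq> {} \<Longrightarrow> ne m B1 < card B1" and f2: "B2 \<noteq> {} \<Longrightarrow> ne m B2 < card B2"
      using forest_onD[OF bounded_forest_on_forest[OF M1] s(1)]
        forest_onD[OF bounded_forest_on_forest[OF M2] s(2)] by auto
    have t1: "Suc (ne m B1) = card B1 \<Longrightarrow> ne m B1 + sum w1 B1 \<le> D"
      and t2: "Suc (ne m B2) = card B2 \<Longrightarrow> ne m B2 + sum w2 B2 \<le> D"
      using bounded_forest_on_tree[OF M1 s(1)] bounded_forest_on_tree[OF M2 s(2)] by auto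
    have l1: "sum w B1 \<le> sum w1 B1" and l2: "sum w B2 \<le> sum w2 B2"
      using s w1 w2 by (auto intro!: sum_mono)
    show ?thesis
    proof (cases "a \<in> B1 \<and> u \<in> B2 \<and> m a u \<noteq> 0")
      case False
      then have "\<forall>x\<in>B1. \<forall>y\<in>B2. m x y = 0"
        using cross s by blast
      then have "cr m B1 B2 = 0"
        using f by (simp add: cr_eq_0)
      then show ?thesis
        using e c ws f1 f2 t1 t2 l1 l2 B
        by (cases "B1 = {}"; cases "B2 = {}") (auto simp: BU)
    next
      case True
      then have au': "m a u = 1" "t \<le> D" "w a + t \<le> w1 a" "w u + (D - t) + 1 \<le> w2 u"
        using au s by blast+
      have "cr m B1 B2 = (\<Sum>x\<in>B1. \<Sum>y\<in>B2. if x = a \<and> y = u then 1 else 0)"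
        unfolding cr_def dg_def using cross s au'(1) by (intro sum.cong refl) auto
      also have "\<dots> = (\<Sum>x\<in>B1. if x = a then 1 else 0)"
        using True f by (intro sum.cong refl) (auto simp: sum.delta)
      also have "\<dots> = 1" using True f by simp
      finally have cr1: "cr m B1 B2 = 1" .
      have ne: "B1 \<noteq> {}" "B2 \<noteq> {}" using True by auto
      have "sum w B1 + t = w a + t + sum w (B1 - {a})"
        using True f by (simp add: sum.remove)
      also have "\<dots> \<le> w1 a + sum w1 (B1 - {a})"
        using au' s w1 by (intro add_mono sum_mono) auto
      also have "\<dots> = sum w1 B1" using True f by (simp add: sum.remove[of B1 a])
      finally have l1': "sum w B1 + t \<le> sum w1 B1" .
      have "sum w B2 + (D - t) + 1 = (w u + (D - t) + 1) + sum w (B2 - {u})"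
        using True f by (simp add: sum.remove)
      also have "\<dots> \<le> w2 u + sum w2 (B2 - {u})"
        using au' s w2 by (intro add_mono sum_mono) auto
      also have "\<dots> = sum w2 B2" using True f by (simp add: sum.remove[of B2 u])
      finally have l2': "sum w B2 + (D - t) + 1 \<le> sum w2 B2" .
      show ?thesis
        using e c ws f1 f2 t1 t2 l1' l2' ne cr1 au'(2) by auto
    qed
  qed
  then show ?thesis
    unfolding bounded_forest_on_def forest_on_def
    by (metis card.empty less_nat_zero_code lessI)
qed

text \<open>In \<open>m'\<close> the set \<open>F1\<close> is contracted to the vertex \<open>f\<close>.\<close>

lemma forest_on_expand:
  assumes m: "mgraph m" "mgraph m'" and fin: "finite F1" "finite F2" and disj: "F1 \<inter> F2 = {}" "f \<notin> F2"
    and F1: "forest_on m F1" and F2: "forest_on m' (insert f F2)"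
    and mm: "\<And>x y. x \<in> F2 \<Longrightarrow> y \<in> F2 \<Longrightarrow> m' x y = m x y"
    and mf: "\<And>y. y \<in> F2 \<Longrightarrow> m' f y = dg m y F1"
  shows "forest_on m (F1 \<union> F2)"
  unfolding forest_on_def
proof (intro allI impI)
  fix B assume B: "B \<subseteq> F1 \<union> F2" "B \<noteq> {}"
  define B1 B2 where "B1 = B \<inter> F1" and "B2 = B \<inter> F2"
  have BU: "B = B1 \<union> B2" and d: "B1 \<inter> B2 = {}" and s: "B1 \<subseteq> F1" "B2 \<subseteq> F2"
    using B disj by (auto simp: B1_def B2_def)
  have f: "finite B1" "finite B2" using s fin finite_subset by auto
  have e: "ne m B = ne m B1 + ne m B2 + cr m B1 B2"
    unfolding BU by (rule ne_Un[OF m(1) f d])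
  have c: "card B = card B1 + card B2"
    unfolding BU using f d by (auto simp: card_Un_disjoint)
  have e2: "ne m' B2 = ne m B2"
    using mm s by (intro ne_cong) auto
  have "cr m B1 B2 = cr m B2 B1" using m cr_sym by metis
  also have "\<dots> \<le> cr m B2 F1" using f fin s by (intro cr_mono) auto
  also have "\<dots> = dg m' f B2" unfolding cr_def dg_def[of m' f] using mf s by (intro sum.cong) auto
  finally have "cr m B1 B2 \<le> dg m' f B2" .
  moreover have fB2: "f \<notin> B2" using s disj by blast
  ultimately have le: "ne m B2 + cr m B1 B2 \<le> ne m' (insert f B2)"
    using ne_insert[OF m(2) f(2) fB2] e2 by simp
  have "ne m' (insert f B2) < card (insert f B2)"
    using F2 s by (intro forest_onD) auto
  then have lt: "ne m' (insert f B2) \<le> card B2"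
    using s disj f by (subst (asm) card_insert_disjoint) auto
  show "ne m B < card B"
  proof (cases "B1 = {}")
    case True
    then have "ne m' B2 < card B2"
      using F2 s B BU by (intro forest_onD[OF F2]) auto
    then show ?thesis using True e2 BU by simp
  next
    case False
    then have "ne m B1 < card B1" using F1 s by (intro forest_onD) auto
    then show ?thesis using e c le lt by linarith
  qed
qed

text \<open>Of at most three edges, one side receives at most one. The slack is demanded only if
  that can be the side \<open>M\<close>, so the end of a multiple edge need not carry any.\<close>

lemma extend_vertex:
  assumes m: "mgraph m" and fin: "finite M" "finite F" and MF: "M \<inter> F = {}" "v \<notin> M" "v \<notin> F"
    and M: "bounded_forest_on D m w' M" and F: "forest_on m F"
    and v: "w v \<le> D" "dg m v (M \<union> F) \<le> 3"
    and w: "\<And>x. x \<in> M \<Longrightarrow> w x \<le> w' x"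
    and slack: "\<And>x. dg m v M \<le> 1 \<Longrightarrow> x \<in> M \<Longrightarrow> w x + m v x * (w v + 1) \<le> w' x"
  obtains M' F' where "M' \<union> F' = insert v (M \<union> F)" "M' \<inter> F' = {}"
    "bounded_forest_on D m w M'" "forest_on m F'"
proof (cases "dg m v F \<le> 1")
  case True
  have "bounded_forest_on D m w M"
    using bounded_forest_on_mono[OF M] w by blast
  moreover have "forest_on m (insert v F)"
    using forest_on_insert[OF m fin(2) F MF(3) True] .
  ultimately show ?thesis
    using that[of M "insert v F"] MF by blast
next
  case False
  then have dM: "dg m v M \<le> 1"
    using v dg_Un[OF fin MF(1), of m v] by simp
  have "bounded_forest_on D m w (insert v M)"
    using bounded_forest_on_insert[where w = w, OF m fin(1) M MF(2) dM v(1)] slack[OF dM] by blast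
  then show ?thesis
    using that[of "insert v M" F] MF F by blast
qed

text \<open>
  If a vertex \<open>v\<close> with two neighbours is deleted and these are joined by a new edge, then \<open>v\<close> can
  always be put back into the forest \<open>F\<close>.
\<close>

definition link :: "('v \<Rightarrow> 'v \<Rightarrow> nat) \<Rightarrow> 'v \<Rightarrow> 'v \<Rightarrow> 'v \<Rightarrow> nat" where
  "link m v x y = (if x = y then 0 else m v x * m v y)"

lemma mgraph_link: "mgraph (link m v)"
  by (simp add: mgraph_def link_def mult.commute)

lemma mgraph_add: "mgraph m \<Longrightarrow> mgraph h \<Longrightarrow> mgraph (\<lambda>x y. m x y + h x y)"
  by (simp add: mgraph_def)

lemma ne_add:
  assumes "mgraph m" "mgraph h" "finite A"
  shows "ne (\<lambda>x y. m x y + h x y) A = ne m A + ne h A"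
proof -
  have "2 * ne (\<lambda>x y. m x y + h x y) A = 2 * ne m A + 2 * ne h A"
    using assms by (simp add: two_ne mgraph_add cr_def dg_def sum.distrib)
  then show ?thesis by simp
qed

text \<open>Over all ordered pairs the products \<open>m v x * m v y\<close> sum to the square of
  the degree \<open>d\<close> into \<open>A\<close>; the diagonal contributes \<open>d\<close>,
  since multiplicities are at most 1. So there are \<open>(d * d - d) / 2\<close> link
  edges.\<close>

lemma ne_link:
  assumes A: "finite A" and le1: "\<And>x. x \<in> A \<Longrightarrow> m v x \<le> 1" and le2: "dg m v A \<le> 2"
  shows "ne (link m v) A = (if dg m v A = 2 then 1 else 0)"
proof -
  have "(\<Sum>y\<in>A. link m v x y) + m v x = m v x * dg m v A" if "x \<in> A" for x
  proof -
    have "m v x * m v x = m v x" using le1[OF that] by (cases "m v x") auto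
    moreover have "(\<Sum>y\<in>A. link m v x y) = link m v x x + (\<Sum>y\<in>A - {x}. link m v x y)"
      using A that by (rule sum.remove)
    moreover have "\<dots> = 0 + (\<Sum>y\<in>A - {x}. m v x * m v y)"
      by (intro arg_cong2[where f = "(+)"] sum.cong) (auto simp: link_def)
    moreover have "m v x * dg m v A = m v x * m v x + (\<Sum>y\<in>A - {x}. m v x * m v y)"
      using dg_remove[OF A that, of m v]
      by (simp add: dg_def[of m v "A - {x}"] distrib_left sum_distrib_left)
    ultimately show ?thesis by linarith
  qed
  then have "(\<Sum>x\<in>A. (\<Sum>y\<in>A. link m v x y) + m v x) = (\<Sum>x\<in>A. m v x * dg m v A)"
    by (intro sum.cong) auto
  then have "(\<Sum>x\<in>A. dg (link m v) x A) + (\<Sum>x\<in>A. m v x) = (\<Sum>x\<in>A. m v x) * dg m v A"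
    by (simp only: sum.distrib dg_def[of "link m v"] sum_distrib_right)
  then have "cr (link m v) A A + dg m v A = dg m v A * dg m v A"
    by (simp only: cr_def flip: dg_def)
  then have eq: "2 * ne (link m v) A + dg m v A = dg m v A * dg m v A"
    using two_ne[OF mgraph_link A, of m v] by simp
  obtain d e where de: "dg m v A = d" "ne (link m v) A = e" by blast
  have "d = 0 \<or> d = 1 \<or> d = 2" using le2 de by linarith
  then show ?thesis using eq unfolding de by auto
qed

text \<open>\<open>m1\<close> may still contain links of other deleted vertices; only its edges at
  \<open>v\<close> have to be those of \<open>m\<close>. This lets several vertices be restored one
  after another.\<close>

lemma forest_on_subdivide:
  assumes m: "mgraph m1" and F: "finite F" "v \<notin> F"
    and forest: "forest_on (\<lambda>x y. m1 x y + link m v x y) F"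
    and eq: "\<And>y. y \<in> F \<Longrightarrow> m1 v y = m v y"
    and le1: "\<And>x. x \<in> F \<Longrightarrow> m v x \<le> 1" and le2: "dg m v F \<le> 2"
  shows "forest_on m1 (insert v F)"
  unfolding forest_on_def
proof (intro allI impI)
  fix B assume B: "B \<subseteq> insert v F" "B \<noteq> {}"
  define B' where "B' = B - {v}"
  have B': "B' \<subseteq> F" "finite B'" "v \<notin> B'" using B F by (auto simp: B'_def intro: finite_subset)
  have le: "dg m v B' \<le> 2" using dg_mono[OF F(1) B'(1), of m v] le2 by simp
  have lk: "ne (link m v) B' = (if dg m v B' = 2 then 1 else 0)"
    using B' le1 le by (intro ne_link) auto
  have lt: "ne m1 B' + ne (link m v) B' < card B'" if "B' \<noteq> {}"
    using forest_onD[OF forest B'(1) that] ne_add[OF m mgraph_link B'(2), of m v] by simp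
  have d: "dg m1 v B' = dg m v B'"
    using eq B' by (intro dg_cong) auto
  show "ne m1 B < card B"
  proof (cases "v \<in> B")
    case True
    then have "B = insert v B'" by (auto simp: B'_def)
    then have "ne m1 B = ne m1 B' + dg m v B'" "card B = Suc (card B')"
      using B' d by (simp_all add: ne_insert[OF m])
    then show ?thesis
      using lt lk le by (cases "B' = {}"; cases "dg m v B' = 2") auto
  next
    case False
    then have "B = B'" by (auto simp: B'_def)
    then show ?thesis using lt B by auto
  qed
qed

text \<open>A vertex of \<open>P\<close> with \<open>k\<close> edges into \<open>X'\<close> spends
  one on itself and makes \<open>k - 1\<close> connections within \<open>X'\<close>; fewer than
  \<open>card X'\<close> of them may occur. By truncated subtraction a vertex without such edges
  adds nothing.\<close>

lemma forest_on_bipartite: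
  assumes m: "mgraph m" and fin: "finite P" "finite X" and disj: "P \<inter> X = {}"
    and indep: "\<And>x y. x \<in> P \<Longrightarrow> y \<in> P \<Longrightarrow> m x y = 0" "\<And>x y. x \<in> X \<Longrightarrow> y \<in> X \<Longrightarrow> m x y = 0"
    and few: "\<And>X'. X' \<subseteq> X \<Longrightarrow> X' \<noteq> {} \<Longrightarrow> (\<Sum>v\<in>P. dg m v X' - 1) < card X'"
  shows "forest_on m (P \<union> X)"
  unfolding forest_on_def
proof (intro allI impI)
  fix B assume B: "B \<subseteq> P \<union> X" "B \<noteq> {}"
  define B1 B2 where "B1 = B \<inter> P" and "B2 = B \<inter> X"
  have BU: "B = B1 \<union> B2" "B1 \<inter> B2 = {}" and s: "B1 \<subseteq> P" "B2 \<subseteq> X"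
    using B disj by (auto simp: B1_def B2_def)
  have f: "finite B1" "finite B2" using s fin finite_subset by auto
  have "cr m B1 B1 = 0" "cr m B2 B2 = 0"
    using f s indep by (auto simp: cr_eq_0 subset_iff)
  then have 0: "ne m B1 = 0" "ne m B2 = 0" by (simp_all add: ne_def)
  have e: "ne m B = cr m B1 B2" "card B = card B1 + card B2"
    using BU f 0 by (simp_all add: ne_Un[OF m] card_Un_disjoint)
  show "ne m B < card B"
  proof (cases "B2 = {}")
    case True
    then show ?thesis using e B BU f by (simp add: card_gt_0_iff)
  next
    case False
    have "cr m B1 B2 \<le> (\<Sum>v\<in>B1. 1 + (dg m v B2 - 1))"
      unfolding cr_def by (rule sum_mono) simp
    also have "\<dots> = card B1 + (\<Sum>v\<in>B1. dg m v B2 - 1)" by (simp only: sum.distrib) simp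
    also have "(\<Sum>v\<in>B1. dg m v B2 - 1) \<le> (\<Sum>v\<in>P. dg m v B2 - 1)"
      by (rule sum_mono2[OF fin(1) s(1)]) simp
    also have "\<dots> < card B2" by (rule few[OF s(2) False])
    finally show ?thesis using e by simp
  qed
qed

section \<open>The potential\<close>

definition kk :: "nat \<Rightarrow> int" where
  "kk D = (if even D then 2 * int D + 1 else 2 * int D + 2)"

text \<open>
  Forcing a vertex of weight 0 into \<open>F\<close> costs exactly as much as one edge. For even \<open>D\<close> this makes
  the total cost \<open>kk D\<close> odd, and one unit of weight costs only 1; for the gap lemma below the cheap unit
  has to be the one just above \<open>D / 2\<close>.
\<close>

definition pw :: "nat \<Rightarrow> nat \<Rightarrow> int" where
  "pw D w = (if w > D then kk D - 1
     else if even D \<and> 2 * w > D then 2 * kk D - 2 * int w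
     else 2 * kk D - 1 - 2 * int w)"

definition rho :: "nat \<Rightarrow> ('v \<Rightarrow> 'v \<Rightarrow> nat) \<Rightarrow> ('v \<Rightarrow> nat) \<Rightarrow> 'v set \<Rightarrow> int" where
  "rho D m w A = (\<Sum>x\<in>A. pw D (w x)) - kk D * int (ne m A)"

lemma pw_lower: "kk D - 1 \<le> pw D w"
  unfolding pw_def kk_def by auto

lemma pw_upper: "pw D w \<le> 2 * kk D - 1"
  unfolding pw_def kk_def by auto

lemma pw_forced: "D < w \<Longrightarrow> pw D w = kk D - 1"
  by (simp add: pw_def)

lemma pw_drop: "pw D w - pw D w' \<le> kk D"
  using pw_lower[of D w'] pw_upper[of D w] by simp

lemma pw_antimono: "w \<le> w' \<Longrightarrow> pw D w' \<le> pw D w"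
  unfolding pw_def kk_def by auto

lemma pw_add: "pw D w - 2 * int t \<le> pw D (w + t)"
  unfolding pw_def kk_def by auto

lemma kk_pos: "0 < kk D"
  by (simp add: kk_def)

text \<open>
  If a vertex of weight \<open>a\<close> can be given \<open>t\<close> more units at the expense \<open>r + 1\<close>, then its
  component has at most \<open>D - t\<close> edges, and attaching that component to a vertex of weight \<open>u\<close>
  costs at most \<open>kk D - r\<close>.
\<close>

lemma pw_balance:
  assumes r: "-1 \<le> r" "r < kk D"
  obtains t where "pw D a - pw D (a + t) \<le> r + 1"
    and "D < a + t \<or> t \<le> D \<and> pw D u - pw D (u + (D - t) + 1) \<le> kk D - r"
proof (cases "even D")
  case False
  define t where "t = nat ((r + 1) div 2)"
  have t: "2 * int t \<le> r + 1" "r \<le> 2 * int t" using r by (auto simp: t_def)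
  have "pw D a - pw D (a + t) \<le> r + 1"
    using pw_add[of D a t] t by simp
  moreover have "t \<le> D" if "\<not> D < a + t" using that by simp
  moreover have "pw D u - pw D (u + (D - t) + 1) \<le> kk D - r" if "t \<le> D"
    using pw_add[of D u "D - t + 1"] that t False by (simp add: kk_def)
  ultimately show ?thesis using that by blast
next
  case True
  then obtain h where h: "D = 2 * h" by auto
  show ?thesis
  proof (cases "even r")
    case False
    define t where "t = nat ((r + 1) div 2)"
    have t: "2 * int t = r + 1" using r False by (auto simp: t_def elim!: oddE)
    have "pw D a - pw D (a + t) \<le> r + 1"
      using pw_add[of D a t] t by simp
    moreover have "pw D u - pw D (u + (D - t) + 1) \<le> kk D - r" if "t \<le> D"
      using pw_add[of D u "D - t + 1"] that t True by (simp add: kk_def)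
    ultimately show ?thesis using that[of t] by fastforce
  next
    case even: True
    define s where "s = nat (r div 2)"
    have s: "2 * int s = r" using r even by (auto simp: s_def)
    have sD: "s \<le> D" using s r True by (simp add: kk_def)
    show ?thesis
    proof (cases "2 * a \<le> D \<and> D < 2 * (a + s + 1)")
      case cross: True
      \<comment> \<open>For even \<open>r\<close> the budget \<open>r + 1\<close> is odd, and only
        the unit just above \<open>D / 2\<close> has an odd price. Here the first
        \<open>s + 1\<close> units at \<open>a\<close> include it, so \<open>a\<close> can afford
        one more than \<open>s\<close>.\<close>
      have "pw D a - pw D (a + (s + 1)) \<le> r + 1"
        using cross s True unfolding pw_def kk_def by auto
      moreover have "D < a + (s + 1) \<or> s + 1 \<le> D \<and>
          pw D u - pw D (u + (D - (s + 1)) + 1) \<le> kk D - r"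
        using pw_add[of D u "D - s"] s sD True by (auto simp: kk_def Suc_diff_Suc)
      ultimately show ?thesis using that by blast
    next
      case nocross: False
      have "pw D a - pw D (a + s) \<le> r + 1"
        using pw_add[of D a s] s by simp
      \<comment> \<open>Unless \<open>a\<close> becomes forced, \<open>s < D / 2\<close>. Then the
        \<open>D - s + 1\<close> units at \<open>u\<close> include the cheap one or overshoot
        \<open>D + 1\<close>, and either saves the missing 1.\<close>
      moreover have "D < a + s \<or> pw D u - pw D (u + (D - s) + 1) \<le> kk D - r"
        using nocross s sD True unfolding pw_def kk_def h by (auto simp: algebra_simps)
      ultimately show ?thesis using that sD by blast
    qed
  qed
qed

lemma rho_empty [simp]: "rho D m w {} = 0"
  by (simp add: rho_def)

lemma rho_Un:
  assumes "mgraph m" "finite A" "finite B" "A \<inter> B = {}"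
  shows "rho D m w (A \<union> B) = rho D m w A + rho D m w B - kk D * int (cr m A B)"
  using assms by (simp add: rho_def ne_Un sum.union_disjoint algebra_simps)

lemma rho_insert:
  assumes "mgraph m" "finite A" "v \<notin> A"
  shows "rho D m w (insert v A) = rho D m w A + pw D (w v) - kk D * int (dg m v A)"
  using assms by (simp add: rho_def ne_insert algebra_simps)

lemma rho_singleton [simp]: "mgraph m \<Longrightarrow> rho D m w {v} = pw D (w v)"
  by (simp add: rho_def)

lemma rho_singleton_ge: "mgraph m \<Longrightarrow> -1 \<le> rho D m w {v}"
  using pw_lower[of D "w v"] kk_pos[of D] by simp

lemma rho_increase:
  assumes "\<And>x. x \<in> A \<Longrightarrow> w' x \<le> w x + \<delta> x"
  shows "rho D m w A - 2 * int (sum \<delta> A) \<le> rho D m w' A"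
proof -
  have "(\<Sum>x\<in>A. pw D (w x) - 2 * int (\<delta> x)) \<le> (\<Sum>x\<in>A. pw D (w' x))"
  proof (rule sum_mono)
    fix x assume "x \<in> A"
    then show "pw D (w x) - 2 * int (\<delta> x) \<le> pw D (w' x)"
      using pw_add[of D "w x" "\<delta> x"] pw_antimono[of "w' x" "w x + \<delta> x" D] assms by fastforce
  qed
  then show ?thesis
    by (simp add: rho_def sum_subtractf sum_distrib_left)
qed

definition wsparse :: "nat \<Rightarrow> ('v \<Rightarrow> 'v \<Rightarrow> nat) \<Rightarrow> ('v \<Rightarrow> nat) \<Rightarrow> 'v set \<Rightarrow> bool" where
  "wsparse D m w V \<longleftrightarrow> (\<forall>A\<subseteq>V. -1 \<le> rho D m w A)"

lemma wsparse_subset: "wsparse D m w V \<Longrightarrow> A \<subseteq> V \<Longrightarrow> wsparse D m w A"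
  by (auto simp: wsparse_def)

lemma wsparseI:
  assumes "mgraph m" "finite V"
    and "\<And>A. A \<subseteq> V \<Longrightarrow> 2 \<le> card A \<Longrightarrow> -1 \<le> rho D m w A"
  shows "wsparse D m w V"
  unfolding wsparse_def
proof (intro allI impI)
  fix A assume A: "A \<subseteq> V"
  then have "finite A" using assms finite_subset by blast
  consider "card A = 0" | "card A = 1" | "2 \<le> card A" by linarith
  then show "-1 \<le> rho D m w A"
  proof cases
    case 1
    then show ?thesis using \<open>finite A\<close> by simp
  next
    case 2
    then obtain v where "A = {v}" by (auto simp: card_1_singleton_iff)
    then show ?thesis using rho_singleton_ge assms by (simp del: rho_singleton)
  next
    case 3
    then show ?thesis using assms A by blast
  qed
qed

section \<open>Minimal counterexamples\<close>

text \<open>Only the number of vertices is minimal: multiplicities and weights of a smaller instance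
  are arbitrary, so links may be added and weights raised freely.\<close>

locale min_counterexample =
  fixes D :: nat and m :: "'v \<Rightarrow> 'v \<Rightarrow> nat" and w :: "'v \<Rightarrow> nat" and V :: "'v set"
  assumes D_pos: "1 \<le> D"
    and fin: "finite V"
    and mg: "mgraph m"
    and sparse: "wsparse D m w V"
    and not_colorable: "\<not> colorable D m w V"
    and smaller: "\<And>m' w' (V' :: 'v set). finite V' \<Longrightarrow> card V' < card V \<Longrightarrow> mgraph m' \<Longrightarrow> wsparse D m' w' V'
      \<Longrightarrow> colorable D m' w' V'"
begin

abbreviation K :: int where "K \<equiv> kk D"
abbreviation r :: "'v set \<Rightarrow> int" where "r \<equiv> rho D m w"

lemma finite_sub: "A \<subseteq> V \<Longrightarrow> finite A"
  using fin finite_subset by blast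

lemma r_ge: "A \<subseteq> V \<Longrightarrow> -1 \<le> r A"
  using sparse by (simp add: wsparse_def)

lemma smallerE:
  assumes "V' \<subseteq> V" "V' \<noteq> V" "mgraph m'" "wsparse D m' w' V'"
  obtains M F where "M \<union> F = V'" "M \<inter> F = {}" "bounded_forest_on D m' w' M" "forest_on m' F"
  using smaller[where V' = V' and m' = m' and w' = w'] assms finite_sub[of V']
    psubset_card_mono[OF fin, of V']
  unfolding colorable_def by blast

lemma colorableI:
  "M \<union> F = V \<Longrightarrow> M \<inter> F = {} \<Longrightarrow> bounded_forest_on D m w M \<Longrightarrow> forest_on m F \<Longrightarrow> False"
  using not_colorable unfolding colorable_def by blast

section \<open>The potential gap of proper vertex sets\<close>

lemma gap:
  assumes "A0 \<subseteq> V" "2 \<le> card A0" "A0 \<noteq> V"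
  shows "K \<le> r A0"
proof (rule ccontr)
  assume small: "\<not> K \<le> r A0"
  define \<A> where "\<A> = {A. A \<subseteq> V \<and> 2 \<le> card A \<and> A \<noteq> V}"
  have "finite \<A>" "\<A> \<noteq> {}"
    using fin assms by (auto simp: \<A>_def)
  then obtain A where A\<A>: "A \<in> \<A>" and min: "\<And>B. B \<in> \<A> \<Longrightarrow> r A \<le> r B"
    using finite_has_minimal[of "r ` \<A>"] by (metis (no_types, lifting) arg_min_if_finite(1) arg_min_least)
  have A: "A \<subseteq> V" "2 \<le> card A" "A \<noteq> V"
    using A\<A> by (auto simp: \<A>_def)
  have finA: "finite A" using A finite_sub by blast
  have rA: "-1 \<le> r A" "r A < K"
    using min[of A0] assms small A r_ge by (auto simp: \<A>_def)
  define S where "S = V - A"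
  have "A \<noteq> {}" using A by auto
  then have S: "S \<subseteq> V" "S \<noteq> {}" "S \<noteq> V" "A \<union> S = V" "A \<inter> S = {}" "finite S"
    using A fin by (auto simp: S_def intro: finite_subset)
  have rS: "r B + r A - K * int (cr m A B) = r (A \<union> B)" if "B \<subseteq> S" for B
  proof -
    have "A \<inter> B = {}" "finite B" using that S finite_subset[of B S] by auto
    then show ?thesis using rho_Un[OF mg finA, of B] by simp
  qed
  have rS_ge: "r A \<le> r (A \<union> B)" if "B \<subseteq> S" "B \<noteq> S" for B
  proof (rule min)
    have "card A \<le> card (A \<union> B)"
      using that S finA by (intro card_mono) (auto intro: finite_subset)
    then show "A \<union> B \<in> \<A>"
      using that S A by (auto simp: \<A>_def)
  qed
  have rV_ge: "-1 \<le> r (A \<union> B)" if "B \<subseteq> S" for B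
    using that S by (intro r_ge) auto
  show False
  proof (cases "\<exists>a\<in>A. \<exists>u\<in>S. m a u \<noteq> 0")
    case False
    obtain M1 F1 where 1: "M1 \<union> F1 = A" "M1 \<inter> F1 = {}" "bounded_forest_on D m w M1" "forest_on m F1"
      using smallerE[OF A(1,3) mg wsparse_subset[OF sparse A(1)]] by blast
    obtain M2 F2 where 2: "M2 \<union> F2 = S" "M2 \<inter> F2 = {}" "bounded_forest_on D m w M2" "forest_on m F2"
      using smallerE[OF S(1,3) mg wsparse_subset[OF sparse S(1)]] by blast
    have f: "finite M1" "finite M2" "finite F1" "finite F2"
      using 1(1) 2(1) finA S(6) by auto
    have b: "bounded_forest_on D m w (M1 \<union> M2)"
      by (rule bounded_forest_on_Un[OF mg f(1,2) _ 1(3) 2(3)]) (use False 1 2 S in auto)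
    have "forest_on m (F1 \<union> F2)"
      by (rule forest_on_Un[OF mg f(3,4) _ 1(4) 2(4)]) (use False 1 2 S in auto)
    then show False
      using b colorableI[of "M1 \<union> M2" "F1 \<union> F2"] 1 2 S by blast
  next
    case True
    then obtain a u where au: "a \<in> A" "u \<in> S" "m a u \<noteq> 0" by blast
    obtain t where t: "pw D (w a) - pw D (w a + t) \<le> r A + 1"
      and t': "D < w a + t \<or> t \<le> D \<and> pw D (w u) - pw D (w u + (D - t) + 1) \<le> K - r A"
      using pw_balance[OF rA] by blast
    \<comment> \<open>Every set of at least two vertices inside \<open>A\<close> has potential at
      least \<open>r A\<close>, so a loss of \<open>r A + 1\<close> at the single vertex
      \<open>a\<close> is harmless.\<close>
    define w1 where "w1 = w(a := w a + t)"
    have "wsparse D m w1 A"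
    proof (rule wsparseI[OF mg finA])
      fix B assume B: "B \<subseteq> A" "2 \<le> card B"
      have "B \<in> \<A>" using A B by (auto simp: \<A>_def)
      then have "r A \<le> r B" by (rule min)
      have finB: "finite B" using B finA finite_subset by blast
      show "-1 \<le> rho D m w1 B"
      proof (cases "a \<in> B")
        case False
        then have "rho D m w1 B = r B"
          by (auto simp: rho_def w1_def intro!: sum.cong)
        then show ?thesis using \<open>r A \<le> r B\<close> rA by simp
      next
        case True
        have "(\<Sum>x\<in>B - {a}. pw D (w1 x)) = (\<Sum>x\<in>B - {a}. pw D (w x))"
          by (rule sum.cong) (auto simp: w1_def)
        then have "rho D m w1 B = r B - (pw D (w a) - pw D (w a + t))"
          using True finB by (simp add: rho_def sum.remove w1_def)
        then show ?thesis using \<open>r A \<le> r B\<close> t by simp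
      qed
    qed
    then obtain MA FA where col: "MA \<union> FA = A" "MA \<inter> FA = {}" "bounded_forest_on D m w1 MA"
        "forest_on m FA"
      using smallerE[OF A(1,3) mg] by blast
    have f: "finite MA" "finite FA" using col(1) finA by auto
    have crA: "cr m A B = cr m B MA + cr m B FA" if "B \<subseteq> S" for B
      using cr_sym[OF mg, of A B] cr_Un2[OF mg f col(2), of B] col(1) by simp
    have w_w1: "w x \<le> w1 x" for x by (simp add: w1_def)
    show False
    proof (cases "\<exists>f\<in>FA. \<exists>y\<in>S. m f y \<noteq> 0")
      case True
      then obtain f y0 where fy: "f \<in> FA" "y0 \<in> S" "m f y0 \<noteq> 0" by blast
      have fS: "f \<notin> S" "f \<in> V" using fy col S A by auto
      \<comment> \<open>The contracted set is represented by one of its own vertices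
        \<open>f\<close>, which lies outside \<open>S\<close>; its weight \<open>D + 1\<close> in
        \<open>w'\<close> keeps it in the forest class.\<close>
      define m' where "m' = (\<lambda>x y. if x = f then (if y = f then 0 else dg m y FA)
        else if y = f then dg m x FA else m x y)"
      define w' where "w' = (\<lambda>y. if y = f \<or> dg m y MA \<noteq> 0 then D + 1 else w y)"
      have mg': "mgraph m'" using mg by (auto simp: mgraph_def m'_def)
      have neS: "ne m' B = ne m B" if "B \<subseteq> S" for B
        using that fS by (intro ne_cong) (auto simp: m'_def)
      have dgf: "dg m' f B = cr m B FA" if "B \<subseteq> S" for B
        using that fS unfolding dg_def[of m'] cr_def by (intro sum.cong) (auto simp: m'_def)
      have rB: "r B - K * int (cr m B MA) \<le> rho D m' w' B" if B: "B \<subseteq> S" for B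
      proof -
        have "(\<Sum>y\<in>B. pw D (w y) - K * int (dg m y MA)) \<le> (\<Sum>y\<in>B. pw D (w' y))"
        proof (rule sum_mono)
          fix y assume "y \<in> B"
          then have "y \<noteq> f" using B fS by auto
          show "pw D (w y) - K * int (dg m y MA) \<le> pw D (w' y)"
          proof (cases "dg m y MA = 0")
            case False
            then have "K * 1 \<le> K * int (dg m y MA)"
              using kk_pos[of D] by (intro mult_left_mono) auto
            then show ?thesis using pw_drop[of D "w y" "w' y"] by simp
          qed (use \<open>y \<noteq> f\<close> in \<open>simp add: w'_def\<close>)
        qed
        then show ?thesis
          by (simp add: rho_def neS[OF B] sum_subtractf cr_def sum_distrib_left)
      qed
      \<comment> \<open>\<open>insert f B\<close> stands for \<open>A \<union> B\<close>: the forced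
        \<open>f\<close> is worth \<open>K - 1\<close>, and \<open>A\<close> has potential at most
        \<open>K - 1\<close>.\<close>
      have rfB: "-1 \<le> rho D m' w' (insert f B)" if B: "B \<subseteq> S" for B
      proof -
        have "rho D m' w' (insert f B) = rho D m' w' B + pw D (w' f) - K * int (cr m B FA)"
          using B fS finite_subset[OF B S(6)] by (subst rho_insert[OF mg']) (auto simp: dgf)
        also have "pw D (w' f) = K - 1" by (simp add: w'_def pw_forced)
        finally show ?thesis
          using rB[OF B] rS[OF B] rV_ge[OF B] rA crA[OF B] by (simp add: algebra_simps)
      qed
      \<comment> \<open>A set avoiding \<open>f\<close> gets no substitute for \<open>A\<close>.
        Either edges towards \<open>FA\<close> are no longer counted, which returns at least
        \<open>K\<close>, or the set differs from \<open>S\<close>, and minimality of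
        \<open>r A\<close> helps.\<close>
      have rB0: "-1 \<le> rho D m' w' B" if B: "B \<subseteq> S" for B
      proof (cases "cr m B FA = 0")
        case True
        show ?thesis
        proof (cases "B = S")
          case True
          then have "m y0 f = 0"
            using \<open>cr m B FA = 0\<close> fy f S by (simp add: cr_eq_0)
          then show ?thesis using fy mg by (simp add: mgraph_sym)
        next
          case False
          then show ?thesis
            using rB[OF B] rS[OF B] rS_ge[OF B] crA[OF B] \<open>cr m B FA = 0\<close> by simp
        qed
      next
        case False
        then have "K * 1 \<le> K * int (cr m B FA)"
          using kk_pos[of D] by (intro mult_left_mono) auto
        then show ?thesis
          using rB[OF B] rS[OF B] rV_ge[OF B] rA crA[OF B] by (simp add: algebra_simps)
      qed
      have "wsparse D m' w' (insert f S)"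
        unfolding wsparse_def
      proof (intro allI impI)
        fix B assume B: "B \<subseteq> insert f S"
        show "-1 \<le> rho D m' w' B"
        proof (cases "f \<in> B")
          case True
          then have "B = insert f (B - {f})" "B - {f} \<subseteq> S" using B by auto
          then show ?thesis using rfB by metis
        next
          case False
          then show ?thesis using rB0 B by blast
        qed
      qed
      moreover have "insert f S \<noteq> V"
      proof
        assume "insert f S = V"
        then have "A \<subseteq> {f}" using S by blast
        then have "card A \<le> 1" using card_mono[of "{f}" A] by simp
        then show False using A by simp
      qed
      ultimately obtain M' F' where col': "M' \<union> F' = insert f S" "M' \<inter> F' = {}"
          "bounded_forest_on D m' w' M'" "forest_on m' F'"
        using smallerE[of "insert f S" m' w'] mg' fS S by blast
      have w'M: "w' x \<le> D" if "x \<in> M'" for x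
        using bounded_forest_on_weight[OF mg' col'(3) that] .
      have "f \<notin> M'" using w'M[of f] by (auto simp: w'_def)
      then have fF': "f \<in> F'" and M'S: "M' \<subseteq> S" using col' by auto
      define F2 where "F2 = F' - {f}"
      have F2: "F2 \<subseteq> S" "F' = insert f F2" "f \<notin> F2" using col' fF' by (auto simp: F2_def)
      have fin2: "finite M'" "finite F2" using M'S F2 S finite_subset by blast+
      have dg0: "dg m x MA = 0" and wx: "w' x = w x" if "x \<in> M'" for x
        using w'M[OF that] \<open>f \<notin> M'\<close> that by (auto simp: w'_def split: if_splits)
      have colM: "bounded_forest_on D m w M'"
        by (rule bounded_forest_on_mono[OF col'(3)])
          (use wx neS M'S in \<open>auto dest: subset_trans\<close>)
      have "bounded_forest_on D m w (MA \<union> M')"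
      proof (rule bounded_forest_on_Un[OF mg f(1) fin2(1) _ col(3) colM])
        show "MA \<inter> M' = {}" using col M'S S by auto
        have *: "m x y = 0" if "x \<in> MA" "y \<in> M'" for x y
          using dg0[OF that(2)] that(1) f mg by (simp add: dg_eq_0 mgraph_sym)
        then show "m x y = 0" if "x \<in> MA" "y \<in> M'" "(x, y) \<noteq> (a, u)" for x y using that by blast
        show "m a u = 1 \<and> t \<le> D \<and> w a + t \<le> w1 a \<and> w u + (D - t) + 1 \<le> w u"
          if "a \<in> MA" "u \<in> M'" "m a u \<noteq> 0" using * that by simp
      qed (use w_w1 in auto)
      moreover have "forest_on m (FA \<union> F2)"
      proof (rule forest_on_expand[OF mg mg' f(2) fin2(2) _ F2(3) col(4)])
        show "FA \<inter> F2 = {}" using col F2 S by auto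
        show "forest_on m' (insert f F2)" using col' F2 by simp
        show "m' x y = m x y" if "x \<in> F2" "y \<in> F2" for x y
          using that F2 by (auto simp: m'_def)
        show "m' f y = dg m y FA" if "y \<in> F2" for y
          using that F2 by (auto simp: m'_def)
      qed
      moreover have "(MA \<union> M') \<union> (FA \<union> F2) = V"
      proof -
        have "M' \<union> F2 = S" using col' F2 fS \<open>f \<notin> M'\<close> by auto
        then show ?thesis using col(1) S(4) by blast
      qed
      moreover have "(MA \<union> M') \<inter> (FA \<union> F2) = {}"
        using col col' M'S F2 S by blast
      ultimately show False using colorableI by blast
    next
      case False
      \<comment> \<open>All edges from \<open>A\<close> to \<open>S\<close> now start in
        \<open>MA\<close>. Forcing all their ends could cost the full set \<open>S\<close> up to
        \<open>r A\<close> too much, so \<open>u\<close> has to save this amount.\<close>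
      then have aM: "a \<in> MA" using au col by blast
      have "\<not> D < w a + t"
        using bounded_forest_on_weight[OF mg col(3) aM] by (simp add: w1_def)
      then have t'': "t \<le> D" "pw D (w u) - pw D (w u + (D - t) + 1) \<le> K - r A"
        using t' by auto
      \<comment> \<open>With a single edge into \<open>A\<close>, \<open>u\<close> is not forced
        outright but receives the remaining \<open>D - t + 1\<close> units. With two or more it is
        forced, and the second edge returns \<open>K > r A\<close>.\<close>
      define w' where "w' = (\<lambda>y. if y = u \<and> dg m u A = 1 then w u + (D - t) + 1
        else if dg m y A \<noteq> 0 then D + 1 else w y)"
      have dgu: "dg m u A \<noteq> 0"
        using au finA mg by (auto simp: dg_eq_0 mgraph_sym)
      have drop: "pw D (w y) - K * int (dg m y A) \<le> pw D (w' y)" for y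
      proof (cases "dg m y A = 0")
        case False
        then have "K * 1 \<le> K * int (dg m y A)"
          using kk_pos[of D] by (intro mult_left_mono) auto
        then show ?thesis using pw_drop[of D "w y" "w' y"] by simp
      qed (use dgu in \<open>auto simp: w'_def\<close>)
      have dropu: "pw D (w u) - K * int (dg m u A) + r A \<le> pw D (w' u)"
      proof (cases "dg m u A = 1")
        case True
        then show ?thesis using t'' by (simp add: w'_def)
      next
        case False
        then have "K * 2 \<le> K * int (dg m u A)"
          using dgu kk_pos[of D] by (intro mult_left_mono) auto
        then show ?thesis using pw_drop[of D "w u" "w' u"] rA by simp
      qed
      have crA': "cr m A B = (\<Sum>y\<in>B. dg m y A)" for B
        using cr_sym[OF mg, of A B] by (simp only: cr_def)
      have "-1 \<le> rho D m w' B" if B: "B \<subseteq> S" for B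
      proof (cases "B = S")
        case False
        have "(\<Sum>y\<in>B. pw D (w y) - K * int (dg m y A)) \<le> (\<Sum>y\<in>B. pw D (w' y))"
          by (intro sum_mono drop)
        then have "r B - K * int (cr m A B) \<le> rho D m w' B"
          by (simp add: rho_def sum_subtractf crA' sum_distrib_left)
        then show ?thesis using rS[OF B] rS_ge[OF B False] by simp
      next
        case True
        have "(\<Sum>y\<in>S - {u}. pw D (w y) - K * int (dg m y A)) \<le> (\<Sum>y\<in>S - {u}. pw D (w' y))"
          by (intro sum_mono drop)
        then have "(\<Sum>y\<in>S. pw D (w y) - K * int (dg m y A)) + r A \<le> (\<Sum>y\<in>S. pw D (w' y))"
          using dropu au S by (simp add: sum.remove)
        then have "r B - K * int (cr m A B) + r A \<le> rho D m w' B"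
          using True by (simp add: rho_def sum_subtractf crA' sum_distrib_left)
        then show ?thesis using rS[OF B] rV_ge[OF B] by simp
      qed
      then obtain M2 F2 where col2: "M2 \<union> F2 = S" "M2 \<inter> F2 = {}" "bounded_forest_on D m w' M2"
          "forest_on m F2"
        using smallerE[OF S(1,3) mg, of w'] by (auto simp: wsparse_def)
      have fin2: "finite M2" "finite F2" using col2 S by auto
      have w'M: "w' x \<le> D" if "x \<in> M2" for x
        using bounded_forest_on_weight[OF mg col2(3) that] .
      have cross: "m x y = 0" if "x \<in> MA" "y \<in> M2" "y \<noteq> u \<or> dg m u A \<noteq> 1" for x y
      proof -
        have "dg m y A = 0" using w'M[OF that(2)] that(3) by (auto simp: w'_def split: if_splits)
        then show ?thesis using that(1) col(1) finA mg by (auto simp: dg_eq_0 mgraph_sym)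
      qed
      have one: "m a u = 1 \<and> (\<forall>x\<in>A. x \<noteq> a \<longrightarrow> m x u = 0)" if "dg m u A = 1"
      proof -
        have "m u a + dg m u (A - {a}) = 1" using that dg_remove[OF finA au(1), of m u] by simp
        moreover have "m u a \<noteq> 0" using au mg by (simp add: mgraph_sym)
        ultimately have "m u a = 1" "dg m u (A - {a}) = 0" by auto
        then show ?thesis using finA mg by (auto simp: dg_eq_0 mgraph_sym)
      qed
      have "bounded_forest_on D m w (MA \<union> M2)"
      proof (rule bounded_forest_on_Un[OF mg f(1) fin2(1) _ col(3) col2(3)])
        show "MA \<inter> M2 = {}" using col col2 S by auto
        show "m x y = 0" if "x \<in> MA" "y \<in> M2" "(x, y) \<noteq> (a, u)" for x y
        proof (cases "y = u \<and> dg m u A = 1")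
          case True
          then have "x \<in> A" "x \<noteq> a" using that col(1) by auto
          then show ?thesis using one True by simp
        next
          case False
          then show ?thesis using cross that by blast
        qed
        show "m a u = 1 \<and> t \<le> D \<and> w a + t \<le> w1 a \<and> w u + (D - t) + 1 \<le> w' u"
          if "a \<in> MA" "u \<in> M2" "m a u \<noteq> 0"
          using cross[of a u] that one t'' by (auto simp: w1_def w'_def)
        show "w x \<le> w' x" if "x \<in> M2" for x
          using w'M[OF that] by (auto simp: w'_def split: if_splits)
      qed (use w_w1 in auto)
      moreover have "forest_on m (FA \<union> F2)"
        by (rule forest_on_Un[OF mg f(2) fin2(2) _ col(4) col2(4)]) (use False col col2 S in auto)
      ultimately show False
        using colorableI[of "MA \<union> M2" "FA \<union> F2"] col col2 S by blast
    qed
  qed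
qed

section \<open>Vertices of small degree\<close>

abbreviation deg :: "'v \<Rightarrow> nat" where "deg v \<equiv> dg m v V"

lemma dg_le_deg: "A \<subseteq> V \<Longrightarrow> dg m v A \<le> deg v"
  by (rule dg_mono[OF fin])

lemma deg_ge_2:
  assumes v: "v \<in> V"
  shows "2 \<le> deg v"
proof (rule ccontr)
  assume "\<not> 2 \<le> deg v"
  obtain M F where MF: "M \<union> F = V - {v}" "M \<inter> F = {}" "bounded_forest_on D m w M" "forest_on m F"
    using smallerE[of "V - {v}" m w] v mg wsparse_subset[OF sparse] by (metis Diff_subset Diff_iff singletonI)
  have "F \<subseteq> V" "v \<notin> F" "v \<notin> M" using MF by auto
  then have "forest_on m (insert v F)"
    using \<open>\<not> 2 \<le> deg v\<close> dg_le_deg[of F v] MF finite_sub by (intro forest_on_insert[OF mg]) auto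
  then show False
    using colorableI[of M "insert v F"] MF v \<open>v \<notin> M\<close> by blast
qed

text \<open>\<open>v\<close> fits into \<open>F\<close> unless two edges go there; with only two
  edges it is then isolated in \<open>M\<close>, where its own weight is all that counts.\<close>

lemma deg_ge_3:
  assumes v: "v \<in> V" and wv: "w v \<le> D"
  shows "3 \<le> deg v"
proof (rule ccontr)
  assume *: "\<not> 3 \<le> deg v"
  obtain M F where MF: "M \<union> F = V - {v}" "M \<inter> F = {}" "bounded_forest_on D m w M" "forest_on m F"
    using smallerE[of "V - {v}" m w] v mg wsparse_subset[OF sparse] by (metis Diff_subset Diff_iff singletonI)
  have s: "F \<subseteq> V" "M \<subseteq> V" "v \<notin> F" "v \<notin> M" using MF by auto
  have f: "finite F" "finite M" using s finite_sub by auto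
  show False
  proof (cases "dg m v F \<le> 1")
    case True
    then have "forest_on m (insert v F)"
      using MF f s by (intro forest_on_insert[OF mg]) auto
    then show False
      using colorableI[of M "insert v F"] MF v s by blast
  next
    case False
    have "dg m v M + dg m v F \<le> deg v"
      using dg_le_deg[of "M \<union> F" v] dg_Un[OF f(2,1) MF(2), of m v] s by simp
    then have 0: "dg m v M = 0" using False * by simp
    then have "m v x = 0" if "x \<in> M" for x using that f by (simp add: dg_eq_0)
    then have "bounded_forest_on D m w (insert v M)"
      using bounded_forest_on_insert[where w = w, OF mg f(2) MF(3) s(4) _ wv] 0 by simp
    then show False
      using colorableI[of "insert v M" F] MF v s by blast
  qed
qed

text \<open>On two vertices either one could form \<open>M\<close>, so both are forced, and two
  parallel edges bring the potential to -2 or less. Three vertices of charge at most -1 will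
  contradict a total of at least -2.\<close>

lemma card_V_ge_3: "3 \<le> card V"
proof (rule ccontr)
  assume "\<not> 3 \<le> card V"
  then consider "card V = 0" | "card V = 1" | "card V = 2" by linarith
  then show False
  proof cases
    case 1
    then have "V = {}" using fin by simp
    then show False using colorableI[of "{}" "{}"] by simp
  next
    case 2
    then obtain v where "V = {v}" by (auto simp: card_1_singleton_iff)
    then show False using deg_ge_2[of v] mg by (simp add: dg_def mgraph_irrefl)
  next
    case 3
    then obtain v u where V: "V = {v, u}" "v \<noteq> u" by (auto simp: card_2_iff)
    have bf: "bounded_forest_on D m w {x}" if "w x \<le> D" for x
      using bounded_forest_on_insert[where w = w and w' = w and M = "{}" and v = x and D = D, OF mg] that by simp
    have ff: "forest_on m {x}" for x
      using forest_on_insert[OF mg _ forest_on_empty, of x] by simp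
    have "{v} \<union> {u} = V" "{v} \<inter> {u} = {}" "{u} \<union> {v} = V" "{u} \<inter> {v} = {}"
      using V by auto
    then have "\<not> w v \<le> D" "\<not> w u \<le> D"
      using colorableI[OF _ _ bf ff] by blast+
    then have wD: "D < w v" "D < w u" by auto
    have "m v u = deg v" using V mg by (simp add: dg_def mgraph_irrefl)
    then have 2: "2 \<le> m v u" using deg_ge_2[of v] V by simp
    have "r V = pw D (w u) + pw D (w v) - K * int (m v u)"
      using V by (simp add: rho_insert[OF mg] dg_def mg)
    also have "\<dots> = 2 * (K - 1) - K * int (m v u)"
      using wD by (simp add: pw_forced)
    also have "\<dots> \<le> 2 * (K - 1) - K * 2"
      using 2 kk_pos[of D] by (intro diff_left_mono mult_left_mono) auto
    finally show False using r_ge[of V] by simp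
  qed
qed

lemma sum_charge: "(\<Sum>v\<in>V. 2 * pw D (w v) - K * int (deg v)) = 2 * r V"
  using two_ne[OF mg fin]
  by (simp add: rho_def sum_subtractf cr_def flip: sum_distrib_left of_nat_sum)

text \<open>Every edge at \<open>v\<close> reserves \<open>w v + 1\<close> units at its other end,
  for at most twice that price. The gap of \<open>A\<close> pays for two edges, whence
  \<open>j\<close>; three edges are paid through \<open>insert v A\<close>, and only
  \<open>insert v A = V\<close> lacks the gap and requires \<open>rV\<close>.\<close>

lemma deg_3_reducible:
  assumes v: "v \<in> V" "deg v = 3" "w v \<le> D" and j: "4 * (int (w v) + 1) \<le> K + 1"
    and rV: "-1 \<le> r V + 3 * K - pw D (w v) - 6 * (int (w v) + 1)"
  shows False
proof -
  define w' where "w' = (\<lambda>x. w x + m v x * (w v + 1))"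
  have "wsparse D m w' (V - {v})"
  proof (rule wsparseI[OF mg])
    fix A assume A: "A \<subseteq> V - {v}" "2 \<le> card A"
    have AV: "A \<subseteq> V" "A \<noteq> V" "v \<notin> A" using A v by auto
    have finA: "finite A" using AV finite_sub by blast
    have rA: "K \<le> r A" using gap AV A by blast
    have "r A - 2 * int (\<Sum>x\<in>A. m v x * (w v + 1)) \<le> rho D m w' A"
      by (rule rho_increase) (simp add: w'_def)
    moreover have "(\<Sum>x\<in>A. m v x * (w v + 1)) = dg m v A * (w v + 1)"
      by (simp only: dg_def sum_distrib_right)
    ultimately have le: "r A - 2 * (int (dg m v A) * (int (w v) + 1)) \<le> rho D m w' A"
      by (simp only: of_nat_mult of_nat_add of_nat_1)
    have "dg m v A \<le> 3" using dg_le_deg[OF AV(1), of v] v by simp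
    then consider "dg m v A = 3" | "dg m v A \<le> 2" by linarith
    then show "-1 \<le> rho D m w' A"
    proof cases
      case 1
      have ins: "r (insert v A) = r A + pw D (w v) - 3 * K"
        using rho_insert[OF mg finA AV(3)] 1 by simp
      show ?thesis
      proof (cases "insert v A = V")
        case True
        then show ?thesis using ins rV le 1 by simp
      next
        case False
        have "K \<le> r (insert v A)"
          using False AV v A finA by (intro gap) auto
        then show ?thesis
          using ins le 1 j pw_upper[of D "w v"] by simp
      qed
    next
      case 2
      then have "int (dg m v A) * (int (w v) + 1) \<le> 2 * (int (w v) + 1)"
        by (intro mult_right_mono) auto
      then show ?thesis using le rA j by simp
    qed
  qed (use fin in simp)
  then obtain M F where MF: "M \<union> F = V - {v}" "M \<inter> F = {}" "bounded_forest_on D m w' M" "forest_on m F"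
    using smallerE[of "V - {v}" m w'] v mg by (metis Diff_subset Diff_iff singletonI)
  have f: "finite M" "finite F" using MF(1) fin finite_subset[of _ V] by blast+
  obtain M' F' where "M' \<union> F' = insert v (M \<union> F)" "M' \<inter> F' = {}"
    "bounded_forest_on D m w M'" "forest_on m F'"
  proof (rule extend_vertex[where w = w, OF mg f MF(2) _ _ MF(3,4) v(3)])
    show "dg m v (M \<union> F) \<le> 3" using MF v dg_le_deg[of "M \<union> F" v] by auto
  qed (use MF in \<open>auto simp: w'_def\<close>)
  then show False using colorableI[of M' F'] MF v by auto
qed

text \<open>For even \<open>D\<close> every vertex has charge at most -1. The tight case, degree 3
  and weight \<open>D div 2\<close>, has exactly -1 because \<open>kk D\<close> is odd.\<close>

lemma odd_D: "odd D"
proof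
  assume ev: "even D"
  have "2 * pw D (w v) - K * int (deg v) \<le> -1" if v: "v \<in> V" for v
  proof (cases "4 \<le> deg v")
    case True
    then have "K * 4 \<le> K * int (deg v)"
      using kk_pos[of D] by (intro mult_left_mono) auto
    then show ?thesis using pw_upper[of D "w v"] by simp
  next
    case False
    show ?thesis
    proof (cases "w v \<le> D")
      case True
      then have d3: "deg v = 3" using deg_ge_3[OF v] False by simp
      have "\<not> 2 * w v < D"
      proof
        assume less: "2 * w v < D"
        then have "2 * w v + 2 \<le> D" using ev by presburger
        then show False
          using deg_3_reducible[OF v d3 True] less ev r_ge[of V]
          by (simp add: kk_def pw_def)
      qed
      then have "2 * pw D (w v) \<le> 3 * K - 1"
        using True ev unfolding pw_def kk_def by (auto elim!: evenE)
      then show ?thesis using d3 by simp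
    next
      case False
      then have "pw D (w v) = K - 1" by (simp add: pw_forced)
      moreover have "K * 2 \<le> K * int (deg v)"
        using deg_ge_2[OF v] kk_pos[of D] by (intro mult_left_mono) auto
      ultimately show ?thesis by simp
    qed
  qed
  then have "(\<Sum>v\<in>V. 2 * pw D (w v) - K * int (deg v)) \<le> (\<Sum>v\<in>V. -1)"
    by (rule sum_mono)
  then have "2 * r V \<le> - int (card V)" by (simp add: sum_charge)
  then show False using r_ge[of V] card_V_ge_3 by simp
qed

text \<open>The charge -2 of such a vertex would pass the later count. It is replaced instead by a
  link between its neighbours, which it subdivides again on returning to \<open>F\<close>; a set
  with both neighbours then has potential one above that of the set with \<open>v\<close>.\<close>

lemma forced_deg_ge_3:
  assumes v: "v \<in> V" and wv: "D < w v"
  shows "3 \<le> deg v"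
proof (rule ccontr)
  assume "\<not> 3 \<le> deg v"
  then have d2: "deg v = 2" using deg_ge_2[OF v] by simp
  have le1: "m v x \<le> 1" if x: "x \<in> V" for x
  proof (rule ccontr)
    assume "\<not> m v x \<le> 1"
    then have 2: "m v x = 2" using dg_ge[OF fin x, of m v] d2 by simp
    then have "x \<noteq> v" using mg mgraph_irrefl by fastforce
    \<comment> \<open>Parallel edges would give the pair \<open>v\<close>, \<open>x\<close> a
      potential below \<open>K\<close>, although it is a proper set.\<close>
    have "r (insert x {v}) = (K - 1) + pw D (w x) - 2 * K"
      using \<open>x \<noteq> v\<close> 2 wv mg by (subst rho_insert[OF mg]) (auto simp: pw_forced dg_def mgraph_sym)
    moreover have "K \<le> r (insert x {v})"
      using \<open>x \<noteq> v\<close> x v card_V_ge_3 by (intro gap) auto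
    ultimately show False using pw_upper[of D "w x"] by simp
  qed
  define m' where "m' = (\<lambda>x y. m x y + link m v x y)"
  have mg': "mgraph m'" unfolding m'_def by (intro mgraph_add mg mgraph_link)
  have ne': "ne m' A = ne m A + (if dg m v A = 2 then 1 else 0)" if "A \<subseteq> V" for A
    unfolding m'_def using that le1 finite_sub[OF that] dg_le_deg[OF that, of v] d2
    by (subst ne_add[OF mg mgraph_link]) (auto simp: ne_link subset_iff)
  have "-1 \<le> rho D m' w A" if A: "A \<subseteq> V - {v}" for A
  proof -
    have AV: "A \<subseteq> V" "v \<notin> A" "finite A" using A finite_sub[of A] by auto
    have eq: "rho D m' w A = r A - K * (if dg m v A = 2 then 1 else 0)"
      using ne'[OF AV(1)] by (simp add: rho_def algebra_simps)
    show ?thesis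
    proof (cases "dg m v A = 2")
      case True
      then have "r (insert v A) = r A + (K - 1) - K * 2"
        using rho_insert[OF mg AV(3,2)] wv by (simp add: pw_forced)
      moreover have "-1 \<le> r (insert v A)" using AV v by (intro r_ge) auto
      ultimately show ?thesis using eq True by simp
    next
      case False
      then show ?thesis using eq r_ge[OF AV(1)] by simp
    qed
  qed
  then obtain M F where MF: "M \<union> F = V - {v}" "M \<inter> F = {}" "bounded_forest_on D m' w M" "forest_on m' F"
    using smallerE[of "V - {v}" m' w] v mg' unfolding wsparse_def by (metis Diff_subset Diff_iff singletonI)
  have s: "F \<subseteq> V" "M \<subseteq> V" "v \<notin> F" "v \<notin> M" using MF by auto
  have "bounded_forest_on D m w M"
    using s by (intro bounded_forest_on_mono[OF MF(3)]) (auto simp: ne' subset_trans)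
  moreover have "forest_on m (insert v F)"
    using s d2 le1 finite_sub[OF s(1)] dg_le_deg[OF s(1), of v] MF(4)
    by (intro forest_on_subdivide[OF mg]) (auto simp: m'_def)
  ultimately show False using colorableI[of M "insert v F"] MF s v by blast
qed

end

section \<open>Odd \<open>D\<close>: the vertices of positive charge\<close>

locale odd_counterexample = min_counterexample D m w V
  for D :: nat and m :: "'v \<Rightarrow> 'v \<Rightarrow> nat" and w :: "'v \<Rightarrow> nat" and V :: "'v set" +
  fixes h :: nat
  assumes D_eq: "D = 2 * h + 1"
begin

lemma K_eq: "K = 4 * int h + 4"
  by (simp add: kk_def D_eq)

lemma h_less_D: "h < D" "h \<le> D"
  by (simp_all add: D_eq)

lemma pw_eq: "i \<le> D \<Longrightarrow> pw D i = 8 * int h + 7 - 2 * int i"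
  using K_eq odd_D by (simp add: pw_def)

lemma pw_h: "pw D h = 6 * int h + 7"
  using pw_eq[of h] h_less_D by simp

text \<open>These are the vertices of positive charge; the charge is 2, and all others have negative charge.\<close>

definition P :: "'v set" where "P = {v \<in> V. deg v = 3 \<and> w v = h}"

definition N :: "'v set" where "N = V - P"

lemma P_N: "P \<subseteq> V" "N \<subseteq> V" "P \<union> N = V" "P \<inter> N = {}" "finite P" "finite N"
  using fin by (auto simp: P_def N_def)

text \<open>Below weight \<open>h\<close> the requirement of \<open>deg_3_reducible\<close> holds
  even for \<open>r V = -1\<close>; at weight \<open>h\<close> it fails by exactly one.\<close>

lemma deg_3_weight:
  assumes "v \<in> V" "deg v = 3"
  shows "h \<le> w v"
proof (rule ccontr)
  assume "\<not> h \<le> w v"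
  then show False
    using deg_3_reducible[OF assms] pw_eq[of "w v"] r_ge[of V] h_less_D K_eq by simp
qed

lemma N_cases:
  assumes "z \<in> N"
  shows "deg z = 3 \<and> h < w z \<or> 4 \<le> deg z"
proof -
  have "3 \<le> deg z"
    using assms deg_ge_3[of z] forced_deg_ge_3[of z] P_N by force
  moreover have "h < w z" if "deg z = 3"
    using assms that deg_3_weight[of z] by (force simp: N_def P_def)
  ultimately show ?thesis by linarith
qed

text \<open>Two types have the smallest deficit 2. For all others three times the deficit minus
  twice the degree is at least 8, more than the total of 6 available in the final count.\<close>

lemma N_charge:
  assumes "z \<in> N"
  obtains "deg z = 4" "w z = 0" "K * int (deg z) - 2 * pw D (w z) = 2"
    | "deg z = 3" "w z = h + 1" "K * int (deg z) - 2 * pw D (w z) = 2"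
    | "4 + int (deg z) \<le> (3 * (K * int (deg z) - 2 * pw D (w z)) - int (deg z))"
      "8 \<le> 3 * (K * int (deg z) - 2 * pw D (w z)) - 2 * int (deg z)"
proof (cases "5 \<le> deg z")
  case True
  then obtain d where "deg z = 5 + d" using le_iff_add by blast
  then have "K * int (deg z) = 20 * int h + 20 + (4 * (int h * int d) + 4 * int d)"
    by (simp add: K_eq algebra_simps)
  moreover have "0 \<le> int h * int d" by (rule mult_nonneg_nonneg) simp_all
  moreover have "pw D (w z) \<le> 8 * int h + 7" using pw_upper[of D "w z"] by (simp add: K_eq)
  moreover have "int (deg z) = 5 + int d" using \<open>deg z = 5 + d\<close> by simp
  moreover have "0 \<le> int h" "0 \<le> int d" by simp_all
  ultimately show ?thesis
    by (intro that(3)) (smt (verit))+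
next
  case False
  then consider "deg z = 3" "h < w z" | "deg z = 4" using N_cases[OF assms] by linarith
  then show ?thesis
  proof cases
    case 1
    show ?thesis
    proof (cases "w z = h + 1")
      case True
      then show ?thesis using that(2) 1 h_less_D by (simp add: K_eq pw_eq)
    next
      case False
      then have "pw D (w z) \<le> pw D (h + 2)" using 1 by (intro pw_antimono) simp
      also have "\<dots> \<le> 6 * int h + 3"
      proof (cases "h + 2 \<le> D")
        case False
        \<comment> \<open>Only for \<open>D = 1\<close> is weight \<open>h + 2\<close> already
          forced, and there \<open>K - 1\<close> equals the same bound 3.\<close>
        then have "h = 0" using D_eq by simp
        then show ?thesis using pw_forced[of D "h + 2"] False by (simp add: K_eq)
      qed (use pw_eq[of "h + 2"] in simp)
      finally show ?thesis using that(3) 1 by (simp add: K_eq)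
    qed
  next
    case 2
    show ?thesis
    proof (cases "w z = 0")
      case True
      then show ?thesis using that(1) 2 by (simp add: K_eq pw_eq)
    next
      case False
      then have "pw D (w z) \<le> pw D 1" by (intro pw_antimono) simp
      also have "\<dots> = 8 * int h + 5" using pw_eq[of 1] D_pos by simp
      finally show ?thesis using that(3) 2 by (simp add: K_eq)
    qed
  qed
qed

text \<open>With \<open>r V\<close> at least 0 the vertices of \<open>P\<close> are reducible as
  well, and without them every charge is negative.\<close>

lemma r_V: "r V = -1"
proof (rule ccontr)
  assume "r V \<noteq> -1"
  then have r0: "0 \<le> r V" using r_ge[of V] by simp
  have "P = {}"
  proof (rule ccontr)
    assume "P \<noteq> {}"
    then obtain v where "v \<in> V" "deg v = 3" "w v = h" by (auto simp: P_def)
    then show False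
      using deg_3_reducible[of v] r0 h_less_D by (simp add: K_eq pw_h)
  qed
  have "2 * pw D (w v) - K * int (deg v) \<le> -1" if "v \<in> V" for v
  proof -
    have "v \<in> N" using that \<open>P = {}\<close> by (simp add: N_def)
    then show ?thesis by (cases rule: N_charge) auto
  qed
  then have "(\<Sum>v\<in>V. 2 * pw D (w v) - K * int (deg v)) \<le> (\<Sum>v\<in>V. -1)"
    by (rule sum_mono)
  then have "2 * r V \<le> - int (card V)" by (simp add: sum_charge)
  then show False using r0 card_V_ge_3 by simp
qed

lemma P_facts: "v \<in> P \<Longrightarrow> v \<in> V" "v \<in> P \<Longrightarrow> deg v = 3" "v \<in> P \<Longrightarrow> w v = h"
  by (auto simp: P_def)

section \<open>Edges at the vertices of positive charge\<close>

lemma P_simple: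
  assumes v: "v \<in> P" and u: "u \<in> V"
  shows "m v u \<le> 1"
proof (rule ccontr)
  assume mu: "\<not> m v u \<le> 1"
  have vV: "v \<in> V" "deg v = 3" "w v = h" using P_facts v by auto
  \<comment> \<open>Only ends of single edges receive weight: if the end of a multiple edge lies in
    \<open>M\<close>, then \<open>v\<close> goes to \<open>F\<close>. Thus at most
    \<open>h + 1\<close> units are spent, which the gap covers.\<close>
  define \<delta> where "\<delta> = (\<lambda>x. if m v x = 1 then h + 1 else 0)"
  define w' where "w' = (\<lambda>x. w x + \<delta> x)"
  have "wsparse D m w' (V - {v})"
  proof (rule wsparseI[OF mg])
    fix A assume A: "A \<subseteq> V - {v}" "2 \<le> card A"
    have AV: "A \<subseteq> V" "A \<noteq> V" using A vV by auto
    have finA: "finite A" using AV finite_sub by blast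
    have rA: "K \<le> r A" using gap AV A by blast
    have "m v u + dg m v (V - {u}) = 3" using dg_remove[OF fin u, of m v] vV by simp
    then have "dg m v (A - {u}) \<le> 1"
      using mu dg_mono[of "V - {u}" "A - {u}" m v] AV fin by fastforce
    then have "dg m v (A - {u}) * (h + 1) \<le> 1 * (h + 1)" by (rule mult_right_mono) simp
    moreover have "sum \<delta> A \<le> dg m v (A - {u}) * (h + 1)"
    proof -
      have "sum \<delta> A = sum \<delta> (A - {u})"
        using mu finA by (intro sum.mono_neutral_right) (auto simp: \<delta>_def)
      also have "\<dots> \<le> (\<Sum>x\<in>A - {u}. m v x * (h + 1))"
        by (rule sum_mono) (simp add: \<delta>_def)
      finally show ?thesis by (simp only: dg_def sum_distrib_right)
    qed
    ultimately have "sum \<delta> A \<le> 1 * (h + 1)" by (rule order_trans[rotated])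
    then have "int (sum \<delta> A) \<le> int (h + 1)" by (simp only: of_nat_le_iff mult_1)
    moreover have "r A - 2 * int (sum \<delta> A) \<le> rho D m w' A"
      by (rule rho_increase) (simp add: w'_def)
    ultimately show "-1 \<le> rho D m w' A" using rA K_eq by simp
  qed (use fin in simp)
  then obtain M F where MF: "M \<union> F = V - {v}" "M \<inter> F = {}" "bounded_forest_on D m w' M" "forest_on m F"
    using smallerE[of "V - {v}" m w'] vV mg by (metis Diff_subset Diff_iff singletonI)
  have f: "finite M" "finite F" using MF(1) fin finite_subset[of _ V] by blast+
  obtain M' F' where "M' \<union> F' = insert v (M \<union> F)" "M' \<inter> F' = {}"
    "bounded_forest_on D m w M'" "forest_on m F'"
  proof (rule extend_vertex[where w = w, OF mg f MF(2) _ _ MF(3,4)])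
    show "dg m v (M \<union> F) \<le> 3" using MF vV dg_le_deg[of "M \<union> F" v] by auto
    fix x assume "dg m v M \<le> 1" "x \<in> M"
    then have "m v x \<le> 1" using dg_ge[OF f(1), of x m v] by simp
    then show "w x + m v x * (w v + 1) \<le> w' x"
      using vV by (cases "m v x") (auto simp: w'_def \<delta>_def)
  qed (use MF h_less_D vV in \<open>auto simp: w'_def\<close>)
  then show False using colorableI[of M' F'] MF vV by auto
qed

lemma wsparse_add:
  assumes V': "V' \<subseteq> V" "V' \<noteq> V"
    and \<delta>: "\<And>A. A \<subseteq> V' \<Longrightarrow> 2 \<le> card A \<Longrightarrow> K \<le> r A \<Longrightarrow>
      \<exists>c. sum \<delta> A \<le> c \<and> 2 * int c \<le> r A + 1"
  shows "wsparse D m (\<lambda>x. w x + \<delta> x) V'"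
proof (rule wsparseI[OF mg])
  show "finite V'" using V' finite_sub by blast
  fix A assume A: "A \<subseteq> V'" "2 \<le> card A"
  have "K \<le> r A" using gap A V' by blast
  then obtain c where c: "sum \<delta> A \<le> c" "2 * int c \<le> r A + 1" using \<delta> A by blast
  have "r A - 2 * int (sum \<delta> A) \<le> rho D m (\<lambda>x. w x + \<delta> x) A"
    by (rule rho_increase) simp
  moreover have "int (sum \<delta> A) \<le> int c" using c by (simp only: of_nat_le_iff)
  ultimately show "-1 \<le> rho D m (\<lambda>x. w x + \<delta> x) A" using c(2) by linarith
qed

lemma sum_dg: "(\<Sum>x\<in>A. m v x * c) = dg m v A * c"
  by (simp only: dg_def sum_distrib_right)

text \<open>Without \<open>x\<close>, \<open>v\<close> keeps two edges, whose reserves cost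
  \<open>4 * (h + 1) = K\<close>. Two vertices of weight \<open>h\<close> and their edge amount to
  \<open>2 * h + 1 = D\<close>, so both may even end up in \<open>M\<close>.\<close>

lemma P_independent:
  assumes v: "v \<in> P" and x: "x \<in> P"
  shows "m v x = 0"
proof (rule ccontr)
  assume "m v x \<noteq> 0"
  then have vx1: "m v x = 1" using P_simple[OF v, of x] P_facts x by force
  have vV: "v \<in> V" "deg v = 3" "w v = h" and xV: "x \<in> V" "deg x = 3" "w x = h"
    using P_facts v x by auto
  have ne: "v \<noteq> x" using vx1 mg mgraph_irrefl by force
  define \<delta> where "\<delta> = (\<lambda>y. m v y * (h + 1))"
  define w' where "w' = (\<lambda>y. w y + \<delta> y)"
  define V' where "V' = V - {v, x}"
  have V': "V' \<subseteq> V" "V' \<noteq> V" "finite V'" "v \<notin> V'" "x \<notin> V'" "V = insert v (insert x V')"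
    using vV xV fin by (auto simp: V'_def)
  have dv: "dg m v V' = 2" and dx: "dg m x V' = 2"
  proof -
    have "deg v = m v x + dg m v V'" "deg x = m v x + dg m x V'"
      using V' ne mg by (simp_all add: V'(6) dg_insert mgraph_irrefl mgraph_sym[of m x v])
    then show "dg m v V' = 2" "dg m x V' = 2" using vV xV vx1 by auto
  qed
  have "wsparse D m w' V'"
    unfolding w'_def
  proof (rule wsparse_add[OF V'(1,2)])
    fix A assume A: "A \<subseteq> V'" "K \<le> r A"
    have "dg m v A * (h + 1) \<le> 2 * (h + 1)"
      using dg_mono[OF V'(3) A(1), of m v] dv by (intro mult_right_mono) auto
    then have "sum \<delta> A \<le> 2 * (h + 1)" by (simp add: \<delta>_def sum_dg del: mult_Suc_right)
    then show "\<exists>c. sum \<delta> A \<le> c \<and> 2 * int c \<le> r A + 1"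
      using A K_eq by (intro exI[of _ "2 * (h + 1)"]) simp
  qed
  then obtain M F where MF: "M \<union> F = V'" "M \<inter> F = {}" "bounded_forest_on D m w' M" "forest_on m F"
    using smallerE[OF V'(1,2) mg] by blast
  have f: "finite M" "finite F" using MF(1) V'(3) by auto
  have nin: "v \<notin> M" "v \<notin> F" "x \<notin> M" "x \<notin> F" using MF V' by auto
  have dsum: "dg m v M + dg m v F = 2" "dg m x M + dg m x F = 2"
    using dg_Un[OF f MF(2), of m] MF(1) dv dx by auto
  show False
  proof (cases "dg m x F \<le> 1")
    case True
    have Fx: "forest_on m (insert x F)"
      by (rule forest_on_insert[OF mg f(2) MF(4) nin(4) True])
    obtain M' F' where "M' \<union> F' = insert v (M \<union> insert x F)" "M' \<inter> F' = {}"
      "bounded_forest_on D m w M'" "forest_on m F'"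
    proof (rule extend_vertex[where w = w, OF mg f(1) _ _ _ _ MF(3) Fx])
      show "dg m v (M \<union> insert x F) \<le> 3"
        using dg_le_deg[of "M \<union> insert x F" v] vV V' MF by fastforce
    qed (use MF nin h_less_D vV ne f in \<open>auto simp: w'_def \<delta>_def\<close>)
    then show False using colorableI[of M' F'] MF V' by auto
  next
    case False
    then have x0: "dg m x M = 0" and "dg m x F = 2" using dsum by auto
    have mx0: "m x y = 0" if "y \<in> M" for y using x0 that f by (simp add: dg_eq_0)
    \<comment> \<open>\<open>x\<close> is isolated in \<open>M\<close> and may be given the full
      weight \<open>D = h + (h + 1)\<close>, which reserves room for \<open>v\<close> and the edge
      between them.\<close>
    define w2 where "w2 = w'(x := D)"
    have Mx: "bounded_forest_on D m w2 (insert x M)"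
    proof (rule bounded_forest_on_insert[OF mg f(1) MF(3) nin(3)])
      show "w2 y + m x y * (w2 x + 1) \<le> w' y" if "y \<in> M" for y
        using that mx0 nin by (auto simp: w2_def)
    qed (use x0 in \<open>auto simp: w2_def\<close>)
    obtain M' F' where "M' \<union> F' = insert v (insert x M \<union> F)" "M' \<inter> F' = {}"
      "bounded_forest_on D m w M'" "forest_on m F'"
    proof (rule extend_vertex[where w = w, OF mg _ f(2) _ _ _ Mx MF(4)])
      show "dg m v (insert x M \<union> F) \<le> 3"
        using dg_le_deg[of "insert x M \<union> F" v] vV V' MF by fastforce
      show "w y + m v y * (w v + 1) \<le> w2 y" if "y \<in> insert x M" for y
        using that vx1 vV xV D_eq by (auto simp: w2_def w'_def \<delta>_def)
      show "w y \<le> w2 y" if "y \<in> insert x M" for y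
        using that xV D_eq by (auto simp: w2_def w'_def)
    qed (use MF nin h_less_D vV ne f in auto)
    then show False using colorableI[of M' F'] MF V' by auto
  qed
qed

text \<open>Without \<open>v1\<close> and \<open>v2\<close>, \<open>z\<close> has one edge and fits
  into \<open>F\<close>. The two nonadjacent vertices return in turn, each on its own reserve, and
  the reserve of \<open>v2\<close> is kept while \<open>v1\<close> is placed.\<close>

lemma deg_3_N_neighbours:
  assumes z: "z \<in> N" "deg z = 3" and v: "v1 \<in> P" "v2 \<in> P" "v1 \<noteq> v2" "m z v1 = 1" "m z v2 = 1"
  shows False
proof -
  have zV: "z \<in> V" "z \<noteq> v1" "z \<noteq> v2" using z v P_N by auto
  have wz: "1 \<le> w z" using N_cases[OF z(1)] z by simp
  have v1: "v1 \<in> V" "deg v1 = 3" "w v1 = h" and v2: "v2 \<in> V" "deg v2 = 3" "w v2 = h"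
    using P_facts v by auto
  have v12: "m v1 v2 = 0" "m v2 v1 = 0" using P_independent v by auto
  define V' where "V' = V - {z, v1, v2}"
  have V': "V' \<subseteq> V" "V' \<noteq> V" "finite V'" "v1 \<notin> V'" "v2 \<notin> V'" "z \<notin> V'"
      "V = insert z (insert v1 (insert v2 V'))"
    using v1 v2 zV fin by (auto simp: V'_def)
  have sym: "m v1 z = 1" "m v2 z = 1" using v mg by (simp_all add: mgraph_sym[of m _ z])
  have d: "dg m v1 V' = 2" "dg m v2 V' = 2" "dg m z V' = 1"
  proof -
    have "deg v1 = 1 + dg m v1 V'" "deg v2 = 1 + dg m v2 V'" "deg z = 2 + dg m z V'"
      using V' zV v mg v12 sym by (simp_all add: V'(7) dg_insert mgraph_irrefl)
    then show "dg m v1 V' = 2" "dg m v2 V' = 2" "dg m z V' = 1" using v1 v2 z by auto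
  qed
  define \<delta> where "\<delta> = (\<lambda>y. m v1 y * (h + 1) + m v2 y * (h + 1))"
  define w' where "w' = (\<lambda>y. w y + \<delta> y)"
  have "wsparse D m w' V'"
    unfolding w'_def
  proof (rule wsparse_add[OF V'(1,2)])
    fix A assume A: "A \<subseteq> V'" "2 \<le> card A" "K \<le> r A"
    have finA: "finite A" using A V' finite_subset by blast
    have nA: "z \<notin> A" "v1 \<notin> A" "v2 \<notin> A" using A V' by auto
    have i: "dg m v1 A \<le> 2" "dg m v2 A \<le> 2" "dg m z A \<le> 1"
      using dg_mono[OF V'(3) A(1), of m] d by metis+
    have \<delta>A: "sum \<delta> A = (dg m v1 A + dg m v2 A) * (h + 1)"
      by (simp only: \<delta>_def sum.distrib sum_dg add_mult_distrib)
    have one: "r A + 6 * int h + 7 - K * int (dg m x A) \<ge> K" if "x = v1 \<or> x = v2" for x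
    proof -
      have "r (insert x A) = r A + pw D (w x) - K * int (dg m x A)"
        using nA that by (intro rho_insert[OF mg finA]) auto
      moreover have "K \<le> r (insert x A)"
        using that nA A finA v1 v2 V' zV by (intro gap) auto
      ultimately show ?thesis using that v1 v2 pw_h by auto
    qed
    \<comment> \<open>If all four edges of \<open>v1\<close> and \<open>v2\<close> end in
      \<open>A\<close>, the reserves cost \<open>8 * (h + 1)\<close>. The set enlarged by
      \<open>z\<close>, \<open>v1\<close>, \<open>v2\<close> supplies this: either the third edge of
      \<open>z\<close> ends in \<open>A\<close> too, or that set is proper and has the gap.\<close>
    have all: "-1 \<le> r A + 2 * (6 * int h + 7) + pw D (w z) - K * int (dg m v1 A + dg m v2 A)
       - K * (2 + int (dg m z A))"
      and all': "dg m z A = 0 \<Longrightarrow> K \<le> r A + 2 * (6 * int h + 7) + pw D (w z) - K * int (dg m v1 A + dg m v2 A)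
       - K * (2 + int (dg m z A))"
    proof -
      let ?B = "insert z (insert v1 (insert v2 A))"
      have eq: "r ?B = r A + 2 * (6 * int h + 7) + pw D (w z) - K * int (dg m v1 A + dg m v2 A)
       - K * (2 + int (dg m z A))"
        using nA finA v zV v12 v1 v2 pw_h
        by (simp add: rho_insert[OF mg] dg_insert algebra_simps)
      have BV: "?B \<subseteq> V" using A V' zV v1 v2 by auto
      then show "-1 \<le> r A + 2 * (6 * int h + 7) + pw D (w z) - K * int (dg m v1 A + dg m v2 A)
       - K * (2 + int (dg m z A))" using r_ge eq by metis
      assume z0: "dg m z A = 0"
      have "?B \<noteq> V"
      proof
        assume "?B = V"
        then have "A = V - {z, v1, v2}" using nA by blast
        then have "A = V'" by (simp add: V'_def)
        then show False using d z0 by simp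
      qed
      moreover have "card A \<le> card ?B" by (rule card_mono) (use finA in auto)
      then have "2 \<le> card ?B" using A by simp
      ultimately show "K \<le> r A + 2 * (6 * int h + 7) + pw D (w z) - K * int (dg m v1 A + dg m v2 A)
       - K * (2 + int (dg m z A))" using gap[OF BV] eq by simp
    qed
    \<comment> \<open>Weight at least 1 is essential here: with weight 0 the bound on
      \<open>r A\<close> would be one short when all four edges and the third edge of
      \<open>z\<close> end in \<open>A\<close>.\<close>
    have pz: "pw D (w z) \<le> 8 * int h + 5"
      using pw_antimono[OF wz, of D] pw_eq[of 1] D_pos by simp
    have "2 * int ((dg m v1 A + dg m v2 A) * (h + 1)) \<le> r A + 1"
    proof -
      have c: "dg m v1 A \<in> {0, 1, 2}" "dg m v2 A \<in> {0, 1, 2}" "dg m z A \<in> {0, 1}"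
        using i by auto
      show ?thesis
      proof (cases "dg m v1 A + dg m v2 A \<le> 3")
        case True
        then show ?thesis
          using c one[of v1] one[of v2] A(3) K_eq by (elim insertE emptyE) (simp_all add: algebra_simps)
      next
        case False
        then have 2: "dg m v1 A = 2" "dg m v2 A = 2" using i by auto
        show ?thesis
          using c(3) all all' pz K_eq by (elim insertE emptyE) (simp_all add: 2 algebra_simps)
      qed
    qed
    moreover have "sum \<delta> A \<le> (dg m v1 A + dg m v2 A) * (h + 1)"
      by (rule eq_refl[OF \<delta>A])
    ultimately show "\<exists>c. sum \<delta> A \<le> c \<and> 2 * int c \<le> r A + 1" by blast
  qed
  then obtain M F where MF: "M \<union> F = V'" "M \<inter> F = {}" "bounded_forest_on D m w' M" "forest_on m F"
    using smallerE[OF V'(1,2) mg] by blast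
  have f: "finite M" "finite F" using MF(1) V'(3) by auto
  have nin: "v1 \<notin> M" "v1 \<notin> F" "v2 \<notin> M" "v2 \<notin> F" "z \<notin> M" "z \<notin> F" using MF V' by auto
  have "dg m z F \<le> 1" using dg_mono[OF V'(3), of F m z] MF d by auto
  then have Fz: "forest_on m (insert z F)"
    by (intro forest_on_insert[OF mg f(2) MF(4) nin(6)])
  define w2 where "w2 = (\<lambda>y. w y + m v2 y * (h + 1))"
  obtain M1 F1 where 1: "M1 \<union> F1 = insert v1 (M \<union> insert z F)" "M1 \<inter> F1 = {}"
    "bounded_forest_on D m w2 M1" "forest_on m F1"
  proof (rule extend_vertex[where w = w2, OF mg f(1) _ _ _ _ MF(3) Fz])
    show "dg m v1 (M \<union> insert z F) \<le> 3"
      using dg_le_deg[of "M \<union> insert z F" v1] v1 V' MF by fastforce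
  qed (use MF nin h_less_D v1 v12 zV f in \<open>auto simp: w'_def w2_def \<delta>_def\<close>)
  have f1: "finite M1" "finite F1" using 1(1) f by (metis finite_Un finite_insert)+
  obtain M2 F2 where 2: "M2 \<union> F2 = insert v2 (M1 \<union> F1)" "M2 \<inter> F2 = {}"
    "bounded_forest_on D m w M2" "forest_on m F2"
  proof (rule extend_vertex[where w = w, OF mg f1 1(2) _ _ 1(3,4)])
    show "dg m v2 (M1 \<union> F1) \<le> 3"
      using dg_le_deg[of "M1 \<union> F1" v2] v2 V' MF 1(1) by fastforce
    have "v2 \<notin> M1 \<union> F1" using 1(1) nin v zV by auto
    then show "v2 \<notin> M1" "v2 \<notin> F1" by auto
  qed (use h_less_D v2 in \<open>auto simp: w2_def\<close>)
  have "M2 \<union> F2 = V" using 2(1) 1(1) MF(1) V'(7) by auto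
  then show False using colorableI 2 by blast
qed

text \<open>Three neighbours are replaced by links and return to \<open>F\<close>; \<open>v4\<close>
  takes the side that suits it, so \<open>z\<close> sees at most \<open>v4\<close> in
  \<open>M\<close>. Linking only three keeps the auxiliary sets away from \<open>v4\<close>, hence
  proper, and the gap applies to them.\<close>

lemma deg_4_neighbours:
  assumes z: "z \<in> N" "deg z = 4" "w z = 0"
    and v: "v1 \<in> P" "v2 \<in> P" "v3 \<in> P" "v4 \<in> P" "distinct [v1, v2, v3, v4]"
    and mz: "m z v1 = 1" "m z v2 = 1" "m z v3 = 1" "m z v4 = 1"
  shows False
proof -
  have zV: "z \<in> V" "z \<noteq> v1" "z \<noteq> v2" "z \<noteq> v3" "z \<noteq> v4" using z v P_N by auto
  have vP: "x \<in> V" "deg x = 3" "w x = h" if "x \<in> {v1, v2, v3, v4}" for x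
    using P_facts v that by auto
  have vv: "m x y = 0" if "x \<in> {v1, v2, v3, v4}" "y \<in> {v1, v2, v3, v4}" for x y
    using P_independent v that by auto
  define V' where "V' = V - {z, v1, v2, v3, v4}"
  have V': "V' \<subseteq> V" "V' \<noteq> V" "finite V'" "v1 \<notin> V'" "v2 \<notin> V'" "v3 \<notin> V'" "v4 \<notin> V'" "z \<notin> V'"
      "V = insert z (insert v1 (insert v2 (insert v3 (insert v4 V'))))"
    using vP zV fin by (auto simp: V'_def)
  have sym: "m v1 z = 1" "m v2 z = 1" "m v3 z = 1" "m v4 z = 1"
    using mz mg by (simp_all add: mgraph_sym[of m _ z])
  have dz: "dg m z V' = 0"
  proof -
    have "deg z = 4 + dg m z V'"
      using V' zV v mg mz by (simp add: V'(9) dg_insert mgraph_irrefl)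
    then show ?thesis using z by simp
  qed
  have d: "dg m x V' = 2" if "x \<in> {v1, v2, v3, v4}" for x
  proof -
    have "deg x = 1 + dg m x V'"
      using that V'(3-8) zV v vv sym
      by (elim insertE emptyE; hypsubst; subst V'(9)) (simp_all add: dg_insert)
    then show ?thesis using vP that by auto
  qed
  have dle: "dg m x A \<le> 2" if "x \<in> {v1, v2, v3, v4}" "A \<subseteq> V'" for x A
    using dg_mono[OF V'(3) that(2), of m x] d[OF that(1)] by simp
  have le1: "m x y \<le> 1" if "x \<in> {v1, v2, v3, v4}" "y \<in> V'" for x y
    using P_simple[of x y] v that V' by auto
  define m1 where "m1 = (\<lambda>x y. m x y + link m v1 x y)"
  define m2 where "m2 = (\<lambda>x y. m1 x y + link m v2 x y)"
  define m3 where "m3 = (\<lambda>x y. m2 x y + link m v3 x y)"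
  have mg1: "mgraph m1" unfolding m1_def by (intro mgraph_add mg mgraph_link)
  have mg2: "mgraph m2" unfolding m2_def by (intro mgraph_add mg1 mgraph_link)
  have mg3: "mgraph m3" unfolding m3_def by (intro mgraph_add mg2 mgraph_link)
  define b where "b x A = (if dg m x A = 2 then 1 else 0 :: nat)" for x A
  have nl: "ne (link m x) A = b x A" if "x \<in> {v1, v2, v3, v4}" "A \<subseteq> V'" for x A
    unfolding b_def using that dle le1 finite_subset[OF that(2) V'(3)]
    by (intro ne_link) (auto simp: subset_iff)
  have ne3: "ne m3 A = ne m A + b v1 A + b v2 A + b v3 A" if A: "A \<subseteq> V'" for A
  proof -
    have fA: "finite A" using A V' finite_subset by blast
    show ?thesis
      using nl[OF _ A] unfolding m3_def m2_def m1_def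
      by (simp add: ne_add fA mg mg1 mg2 mgraph_link mgraph_add)
  qed
  have "wsparse D m3 w V'"
  proof (rule wsparseI[OF mg3 V'(3)])
    fix A assume A: "A \<subseteq> V'" "2 \<le> card A"
    have finA: "finite A" using A V' finite_subset by blast
    have nA: "z \<notin> A" "v1 \<notin> A" "v2 \<notin> A" "v3 \<notin> A" "v4 \<notin> A" using A V' by auto
    have AV: "A \<subseteq> V" "A \<noteq> V" using A V' by auto
    have rA: "K \<le> r A" using gap AV A by blast
    have z0: "dg m z A = 0" using dg_mono[OF V'(3) A(1), of m z] dz by simp
    have eq: "rho D m3 w A = r A - K * int (b v1 A + b v2 A + b v3 A)"
      using ne3[OF A(1)] by (simp add: rho_def algebra_simps)
    have gapY: "K \<le> r (Y \<union> A)" if "Y \<subseteq> {z, v1, v2, v3}" for Y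
    proof (rule gap)
      show "Y \<union> A \<subseteq> V" using that AV zV vP by auto
      show "2 \<le> card (Y \<union> A)"
        using A finA card_mono[of "Y \<union> A" A] finite_subset[OF that] by auto
      show "Y \<union> A \<noteq> V" using that nA vP[of v4] v(5) zV by auto
    qed
    have pz: "pw D (w z) = 8 * int h + 7" using z pw_eq[of 0] by simp
    \<comment> \<open>Two links cost \<open>2 * K\<close>, and the gap of the set enlarged by
      \<open>z\<close>, \<open>x\<close>, \<open>y\<close> yields exactly \<open>2 * K - 1\<close>
      as a lower bound for \<open>r A\<close>.\<close>
    have two: "r A + 20 * int h + 21 - 6 * K \<ge> K"
      if "dg m x A = 2" "dg m y A = 2" "x \<noteq> y" "x \<in> {v1, v2, v3}" "y \<in> {v1, v2, v3}" for x y
    proof -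
      have "r (insert z (insert x (insert y A))) = r A + 20 * int h + 21 - 6 * K"
        using that nA finA zV vv[of x y] vP[of x] vP[of y] pz pw_h z0 mz
        by (auto simp: rho_insert[OF mg] dg_insert algebra_simps)
      then show ?thesis using gapY[of "{z, x, y}"] that by auto
    qed
    have three: "r A + 26 * int h + 28 - 9 * K \<ge> K"
      if "dg m v1 A = 2" "dg m v2 A = 2" "dg m v3 A = 2"
    proof -
      have "r (insert z (insert v1 (insert v2 (insert v3 A)))) = r A + 26 * int h + 28 - 9 * K"
        using that nA finA zV v vv vP pz pw_h z0 mz
        by (simp add: rho_insert[OF mg] dg_insert algebra_simps)
      then show ?thesis using gapY[of "{z, v1, v2, v3}"] by simp
    qed
    have "dg m v1 A = 2 \<Longrightarrow> dg m v2 A = 2 \<Longrightarrow> 8 * int h + 7 \<le> r A"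
      "dg m v1 A = 2 \<Longrightarrow> dg m v3 A = 2 \<Longrightarrow> 8 * int h + 7 \<le> r A"
      "dg m v2 A = 2 \<Longrightarrow> dg m v3 A = 2 \<Longrightarrow> 8 * int h + 7 \<le> r A"
      using two[of v1 v2] two[of v1 v3] two[of v2 v3] v(5) K_eq by simp_all
    moreover have "dg m v1 A = 2 \<Longrightarrow> dg m v2 A = 2 \<Longrightarrow> dg m v3 A = 2 \<Longrightarrow> 14 * int h + 12 \<le> r A"
      using three K_eq by simp
    ultimately show "-1 \<le> rho D m3 w A"
      using rA unfolding eq b_def K_eq
      by (cases "dg m v1 A = 2"; cases "dg m v2 A = 2"; cases "dg m v3 A = 2") simp_all
  qed
  then obtain M F where MF: "M \<union> F = V'" "M \<inter> F = {}" "bounded_forest_on D m3 w M" "forest_on m3 F"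
    using smallerE[OF V'(1,2) mg3] by blast
  have f: "finite M" "finite F" using MF(1) V'(3) by auto
  have sub: "M \<subseteq> V'" "F \<subseteq> V'" using MF by auto
  have nin: "x \<notin> M" "x \<notin> F" if "x \<in> {z, v1, v2, v3, v4}" for x using sub V' that by auto
  have lk: "link m x y u = 0" if "x \<in> {v1, v2, v3}" "y \<in> {v1, v2, v3} \<or> u \<in> {v1, v2, v3}" for x y u
  proof -
    have "m x y = 0 \<or> m x u = 0" using that vv[of x y] vv[of x u] by auto
    then show ?thesis by (auto simp: link_def)
  qed
  have le1F: "m x y \<le> 1" if "x \<in> {v1, v2, v3}" "y \<in> insert v1 (insert v2 (insert v3 F))" for x y
  proof (cases "y \<in> F")
    case True
    then show ?thesis using le1[of x y] that(1) sub by auto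
  next
    case False
    then show ?thesis using vv[of x y] that by auto
  qed
  have nF: "v1 \<notin> F" "v2 \<notin> F" "v3 \<notin> F" using nin by auto
  have dF: "dg m x F \<le> 2" if "x \<in> {v1, v2, v3}" for x using dle[of x F] sub that by auto
  have dF2: "dg m v2 (insert v3 F) \<le> 2"
    using dF[of v2] vv[of v2 v3] by (simp add: dg_insert f nF)
  have dF1: "dg m v1 (insert v2 (insert v3 F)) \<le> 2"
    using dF[of v1] vv[of v1 v2] vv[of v1 v3] v(5) by (simp add: dg_insert f nF)
  have F3: "forest_on m2 (insert v3 F)"
  proof (rule forest_on_subdivide[OF mg2 f(2) nF(3)])
    show "m2 v3 y = m v3 y" for y using lk by (simp add: m2_def m1_def)
    show "forest_on (\<lambda>x y. m2 x y + link m v3 x y) F" using MF(4) by (simp add: m3_def)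
    show "dg m v3 F \<le> 2" by (rule dF) simp
    show "m v3 x \<le> 1" if "x \<in> F" for x by (rule le1F) (use that in auto)
  qed
  have F2: "forest_on m1 (insert v2 (insert v3 F))"
  proof (rule forest_on_subdivide[OF mg1 _ _ _ _ _ dF2])
    show "finite (insert v3 F)" using f by simp
    show "v2 \<notin> insert v3 F" using nF v(5) by simp
    show "m1 v2 y = m v2 y" for y using lk by (simp add: m1_def)
    show "forest_on (\<lambda>x y. m1 x y + link m v2 x y) (insert v3 F)" using F3 by (simp add: m2_def)
    show "m v2 x \<le> 1" if "x \<in> insert v3 F" for x by (rule le1F) (use that in auto)
  qed
  have F1: "forest_on m (insert v1 (insert v2 (insert v3 F)))"
  proof (rule forest_on_subdivide[OF mg _ _ _ _ _ dF1])
    show "finite (insert v2 (insert v3 F))" using f by simp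
    show "v1 \<notin> insert v2 (insert v3 F)" using nF v(5) by simp
    show "forest_on (\<lambda>x y. m x y + link m v1 x y) (insert v2 (insert v3 F))"
      using F2 by (simp add: m1_def)
    show "m v1 x \<le> 1" if "x \<in> insert v2 (insert v3 F)" for x by (rule le1F) (use that in auto)
  qed simp
  define F' where "F' = insert v1 (insert v2 (insert v3 F))"
  have f': "finite F'" "forest_on m F'" using f F1 by (auto simp: F'_def)
  have M: "bounded_forest_on D m w M"
    using sub by (intro bounded_forest_on_mono[OF MF(3)]) (auto simp: ne3 subset_trans)
  have dvF: "dg m v4 F' = dg m v4 F"
    unfolding F'_def using f nin vv v by (simp add: dg_insert)
  have dv4: "dg m v4 M + dg m v4 F = 2"
    using dg_Un[OF f MF(2), of m v4] MF(1) d[of v4] by simp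
  have zM: "dg m z M = 0" using dg_mono[OF V'(3) sub(1), of m z] dz by simp
  then have mzM: "m z y = 0" if "y \<in> M" for y using f that by (simp add: dg_eq_0)
  show False
  proof (cases "dg m v4 F \<le> 1")
    case True
    have "forest_on m (insert v4 F')"
      using True dvF nin v by (intro forest_on_insert[OF mg f']) (auto simp: F'_def)
    moreover have "bounded_forest_on D m w (insert z M)"
      using zM mzM z nin by (intro bounded_forest_on_insert[OF mg f(1) M]) auto
    moreover have "insert z M \<union> insert v4 F' = V" "insert z M \<inter> insert v4 F' = {}"
      using MF nin zV v V'(9) by (auto simp: F'_def)
    ultimately show False using colorableI by blast
  next
    case False
    then have v4M: "dg m v4 M = 0" using dv4 by simp
    then have mvM: "m v4 y = 0" if "y \<in> M" for y using f that by (simp add: dg_eq_0)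
    \<comment> \<open>\<open>v4\<close> is isolated in \<open>M\<close>; beyond its own weight
      \<open>h\<close>, one unit is reserved for the edge to \<open>z\<close>, which has weight
      0.\<close>
    have "bounded_forest_on D m (w(v4 := h + 1)) (insert v4 M)"
      using v4M mvM nin h_less_D by (intro bounded_forest_on_insert[OF mg f(1) M]) auto
    then have "bounded_forest_on D m w (insert z (insert v4 M))"
    proof (rule bounded_forest_on_insert[OF mg, rotated])
      show "dg m z (insert v4 M) \<le> 1" using zM f nin mz by (simp add: dg_insert)
    qed (use mzM z nin f zV mz vP in auto)
    moreover have "insert z (insert v4 M) \<union> F' = V" "insert z (insert v4 M) \<inter> F' = {}"
      using MF nin zV v V'(9) by (auto simp: F'_def)
    ultimately show False using colorableI f' by blast
  qed
qed

section \<open>Odd \<open>D\<close>: the final colouring\<close>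

lemma mNP: "z \<in> N \<Longrightarrow> v \<in> P \<Longrightarrow> m z v \<le> 1" "z \<in> N \<Longrightarrow> v \<in> P \<Longrightarrow> m v z \<le> 1"
  using P_simple[of v z] P_N mg by (auto simp: mgraph_sym[of m z v])

lemma dg_V: "deg x = dg m x P + dg m x N"
  using dg_Un[of P N m x] P_N by simp

lemma P_dg: "v \<in> P \<Longrightarrow> dg m v P = 0" "v \<in> P \<Longrightarrow> dg m v N = 3"
proof -
  assume v: "v \<in> P"
  show "dg m v P = 0" using P_independent[OF v] P_N by (simp add: dg_eq_0)
  then show "dg m v N = 3" using dg_V[of v] P_facts v by simp
qed

lemma dg_P_card: "z \<in> N \<Longrightarrow> dg m z P = card {v \<in> P. m z v = 1}"
proof -
  assume z: "z \<in> N"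
  have "dg m z P = (\<Sum>v\<in>P. if m z v = 1 then 1 else 0)"
    unfolding dg_def
  proof (rule sum.cong)
    fix v assume "v \<in> P"
    then have "m z v \<le> 1" using mNP z by blast
    then show "m z v = (if m z v = 1 then 1 else 0)" by auto
  qed simp
  also have "\<dots> = card {v \<in> P. m z v = 1}"
    using P_N by (simp add: sum.If_cases Int_def)
  finally show ?thesis .
qed

lemma dg_P_le:
  assumes z: "z \<in> N"
  shows "deg z = 3 \<Longrightarrow> dg m z P \<le> 1" "deg z = 4 \<Longrightarrow> w z = 0 \<Longrightarrow> dg m z P \<le> 3"
proof -
  obtain xs where xs: "set xs = {v \<in> P. m z v = 1}" "distinct xs"
    using finite_distinct_list[of "{v \<in> P. m z v = 1}"] P_N by auto
  then have len: "length xs = dg m z P" using dg_P_card[OF z] distinct_card by metis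
  show "dg m z P \<le> 1" if "deg z = 3"
  proof (rule ccontr)
    assume "\<not> dg m z P \<le> 1"
    then obtain a b ys where "xs = a # b # ys"
      using len by (cases xs; cases "tl xs") auto
    then show False using deg_3_N_neighbours[OF z that, of a b] xs by auto
  qed
  show "dg m z P \<le> 3" if "deg z = 4" "w z = 0"
  proof (rule ccontr)
    assume "\<not> dg m z P \<le> 3"
    then have "4 \<le> length xs" using len by simp
    then obtain a b c d ys where "xs = a # b # c # d # ys"
      by (auto simp: numeral_eq_Suc Suc_le_length_iff)
    then show False using deg_4_neighbours[OF z that, of a b c d] xs by auto
  qed
qed

text \<open>Every vertex of \<open>P\<close> passes a third of its charge to each of its three neighbours.\<close>

lemma N_excess:
  shows N_types: "z \<in> N \<Longrightarrow> dg m z P \<le> 3 \<and>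
      (deg z = 4 \<and> w z = 0 \<or> deg z = 3 \<and> w z = h + 1 \<and> dg m z P \<le> 1)"
    and sum_excess: "(\<Sum>z\<in>N. 3 - dg m z P) = 3"
proof -
  define c where "c = (\<lambda>z. K * int (deg z) - 2 * pw D (w z))"
  \<comment> \<open>The deficit left after \<open>P\<close> has given \<open>2 / 3\<close> along
    every edge, multiplied by 3. Since \<open>r V = -1\<close>, the total is 6.\<close>
  define ex where "ex = (\<lambda>z. 3 * c z - 2 * int (dg m z P))"
  have "(\<Sum>v\<in>V. 2 * pw D (w v) - K * int (deg v)) = (\<Sum>v\<in>V. - c v)"
    by (rule sum.cong) (simp_all add: c_def)
  then have "(\<Sum>v\<in>P. - c v) + (\<Sum>v\<in>N. - c v) = -2"
    using sum_charge r_V sum.union_disjoint[of P N "\<lambda>v. - c v"] P_N by simp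
  moreover have "(\<Sum>v\<in>P. - c v) = (\<Sum>v\<in>P. 2)"
    by (rule sum.cong) (simp_all add: c_def P_facts pw_h K_eq)
  ultimately have sc: "(\<Sum>z\<in>N. c z) = 2 * int (card P) + 2"
    by (simp add: sum_negf)
  have "(\<Sum>z\<in>N. dg m z P) = cr m P N" using cr_sym[OF mg, of N P] by (simp only: cr_def)
  also have "\<dots> = (\<Sum>v\<in>P. 3)" unfolding cr_def by (rule sum.cong) (simp_all add: P_dg)
  finally have ss: "(\<Sum>z\<in>N. int (dg m z P)) = 3 * int (card P)"
    by (simp flip: of_nat_sum)
  have se: "(\<Sum>z\<in>N. ex z) = 6"
    unfolding ex_def sum_subtractf using sc ss by (simp flip: sum_distrib_left)
  have ge: "0 \<le> ex z" and big: "deg z = 4 \<and> w z = 0 \<and> c z = 2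
      \<or> deg z = 3 \<and> w z = h + 1 \<and> c z = 2 \<or> 8 \<le> ex z" if z: "z \<in> N" for z
  proof -
    have "dg m z P \<le> deg z" using dg_le_deg[of P z] P_N by simp
    then show "deg z = 4 \<and> w z = 0 \<and> c z = 2
      \<or> deg z = 3 \<and> w z = h + 1 \<and> c z = 2 \<or> 8 \<le> ex z"
      using N_charge[OF z] unfolding ex_def c_def by (smt (verit) of_nat_mono)
    then show "0 \<le> ex z" using dg_P_le[OF z] unfolding ex_def by auto
  qed
  have le: "ex z \<le> 6" if z: "z \<in> N" for z
    using member_le_sum[OF z, of ex] ge se P_N by simp
  have small: "deg z = 4 \<and> w z = 0 \<and> c z = 2 \<or> deg z = 3 \<and> w z = h + 1 \<and> c z = 2"
    if z: "z \<in> N" for z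
    using big[OF z] le[OF z] by linarith
  show *: "dg m z P \<le> 3 \<and>
      (deg z = 4 \<and> w z = 0 \<or> deg z = 3 \<and> w z = h + 1 \<and> dg m z P \<le> 1)" if z: "z \<in> N" for z
    using small[OF z] dg_P_le[OF z] by auto
  have "(\<Sum>z\<in>N. int (3 - dg m z P)) * 2 = (\<Sum>z\<in>N. ex z)"
    unfolding sum_distrib_right
  proof (rule sum.cong)
    fix z assume "z \<in> N"
    then show "int (3 - dg m z P) * 2 = ex z" using small[of z] *[of z] by (auto simp: ex_def)
  qed simp
  then have "int (\<Sum>z\<in>N. 3 - dg m z P) = 3" using se by (simp only: of_nat_sum)
  then show "(\<Sum>z\<in>N. 3 - dg m z P) = 3" by linarith
qed

text \<open>The class \<open>M\<close> consists of single edges and vertices of weight 0 from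
  \<open>N\<close> and of isolated vertices of weight \<open>h\<close> from \<open>Q\<close>, so its
  trees respect every \<open>D\<close>.\<close>

lemma recolour:
  assumes X: "X \<subseteq> N" and Q: "Q \<subseteq> P"
    and w0: "\<And>z. z \<in> N - X \<Longrightarrow> w z = 0" and deg1: "\<And>z. z \<in> N - X \<Longrightarrow> dg m z (N - X) \<le> 1"
    and F: "forest_on m ((P - Q) \<union> X)" and Q0: "\<And>v. v \<in> Q \<Longrightarrow> dg m v (N - X) = 0"
  shows False
proof -
  define M where "M = (N - X) \<union> Q"
  have fin': "finite (N - X)" "finite Q" "finite M"
    using P_N Q finite_subset by (auto simp: M_def)
  have disj: "(N - X) \<inter> Q = {}" using Q P_N by auto
  have zero: "m v z = 0" "m z v = 0" if "v \<in> Q" "z \<in> N - X" for v z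
    using Q0[OF that(1)] that fin' mg by (auto simp: dg_eq_0 mgraph_sym[of m z v])
  have dQ: "dg m v M = 0" if "v \<in> Q" for v
    using Q0[OF that] dg_Un[OF fin'(1,2) disj, of m v] P_independent[of v] Q that fin'
    by (auto simp: M_def dg_eq_0)
  have dX: "dg m z M \<le> 1" if "z \<in> N - X" for z
  proof -
    have "dg m z Q = 0" using zero(2)[OF _ that] fin' by (simp add: dg_eq_0)
    then show ?thesis
      using deg1[OF that] dg_Un[OF fin'(1,2) disj, of m z] by (simp add: M_def)
  qed
  have "ne m B < card B \<and> (Suc (ne m B) = card B \<longrightarrow> ne m B + sum w B \<le> D)"
    if B: "B \<subseteq> M" "B \<noteq> {}" for B
  proof -
    have fB: "finite B" using B fin' finite_subset by blast
    have dB: "dg m x B \<le> (if x \<in> Q then 0 else 1)" if "x \<in> B" for x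
      using dg_mono[OF fin'(3) B(1), of m x] dQ[of x] dX[of x] that B by (auto simp: M_def)
    then have "2 * ne m B \<le> (\<Sum>x\<in>B. if x \<in> Q then 0 else 1)"
      unfolding two_ne[OF mg fB] cr_def by (intro sum_mono) auto
    also have "\<dots> = card (B - Q)" using fB by (simp add: sum.If_cases Diff_eq)
    finally have ne2: "2 * ne m B \<le> card (B - Q)" .
    have cB: "card (B - Q) \<le> card B" using fB by (intro card_mono) auto
    have pos: "0 < card B" using B fB by (simp add: card_gt_0_iff)
    have "ne m B + sum w B \<le> D" if tree: "Suc (ne m B) = card B"
    proof -
      consider "ne m B = 0" | "ne m B = 1" using tree ne2 cB by linarith
      then show ?thesis
      proof cases
        case 1
        then obtain x where x: "B = {x}" using tree by (metis card_1_singletonE One_nat_def)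
        then have "w x \<le> h"
          using B w0[of x] P_facts(3)[of x] Q by (auto simp: M_def)
        then show ?thesis using 1 x h_less_D by simp
      next
        case 2
        then have "card (B - Q) = card B" using tree ne2 cB by linarith
        then have "B - Q = B" using fB by (intro card_subset_eq) auto
        then have "w x = 0" if "x \<in> B" for x using that w0[of x] B by (auto simp: M_def)
        then show ?thesis using 2 D_pos by simp
      qed
    qed
    then show ?thesis using ne2 cB pos by linarith
  qed
  then have "bounded_forest_on D m w M"
    unfolding bounded_forest_on_def forest_on_def
    by (metis card.empty less_nat_zero_code lessI)
  moreover have "M \<union> ((P - Q) \<union> X) = V" "M \<inter> ((P - Q) \<union> X) = {}"
    using X Q P_N by (auto simp: M_def)
  ultimately show False using colorableI F by blast
qed

section \<open>Common neighbours in \<open>P\<close>, and forests with few vertices of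
  \<open>N\<close>\<close>

definition sh :: "'v \<Rightarrow> 'v \<Rightarrow> nat" where
  "sh x y = (\<Sum>v\<in>P. m v x * m v y)"

lemma sh_sym: "sh x y = sh y x"
  by (simp add: sh_def mult.commute)

lemma forest_one:
  assumes x: "x \<in> N"
  shows "forest_on m (P \<union> {x})"
proof (rule forest_on_bipartite[OF mg])
  fix X' assume "X' \<subseteq> {x}" "X' \<noteq> {}"
  then have "X' = {x}" by blast
  moreover have "(\<Sum>v\<in>P. dg m v {x} - 1) = 0"
    using mNP x by (auto simp: dg_def)
  ultimately show "(\<Sum>v\<in>P. dg m v X' - 1) < card X'" by simp
qed (use P_N x P_independent mg in \<open>auto simp: mgraph_irrefl\<close>)

lemma pair_sum:
  assumes "x \<in> N" "y \<in> N" "x \<noteq> y"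
  shows "(\<Sum>v\<in>P. dg m v {x, y} - 1) = sh x y"
  unfolding sh_def
proof (rule sum.cong)
  fix v assume "v \<in> P"
  then have "m v x \<le> 1" "m v y \<le> 1" using mNP assms by auto
  then have "m v x \<in> {0, 1}" "m v y \<in> {0, 1}" by auto
  then show "dg m v {x, y} - 1 = m v x * m v y"
    using assms by (auto simp: dg_def)
qed simp

lemma single_sum: "x \<in> N \<Longrightarrow> (\<Sum>v\<in>P. dg m v {x} - 1) = 0"
  using mNP by (auto simp: dg_def)

lemma forest_two:
  assumes x: "x \<in> N" "y \<in> N" "x \<noteq> y" "m x y = 0" and sh: "sh x y \<le> 1"
  shows "forest_on m (P \<union> {x, y})"
proof (rule forest_on_bipartite[OF mg])
  fix X' assume "X' \<subseteq> {x, y}" "X' \<noteq> {}"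
  then consider "X' = {x}" | "X' = {y}" | "X' = {x, y}" by blast
  then show "(\<Sum>v\<in>P. dg m v X' - 1) < card X'"
    using single_sum pair_sum x sh by cases simp_all
qed (use P_N x P_independent mg in \<open>auto simp: mgraph_irrefl mgraph_sym[of m y x]\<close>)

lemma forest_three:
  assumes x: "x \<in> N" "y \<in> N" "z \<in> N" "x \<noteq> y" "x \<noteq> z" "y \<noteq> z" "m x y = 0" "m x z = 0" "m y z = 0"
    and sh: "sh x y \<le> 1" "sh x z \<le> 1" "sh y z \<le> 1"
    and triple: "(\<Sum>v\<in>P. dg m v {x, y, z} - 1) \<le> 2"
  shows "forest_on m (P \<union> {x, y, z})"
proof (rule forest_on_bipartite[OF mg])
  fix X' assume "X' \<subseteq> {x, y, z}" "X' \<noteq> {}"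
  then consider "X' = {x}" | "X' = {y}" | "X' = {z}" | "X' = {x, y}" | "X' = {x, z}" | "X' = {y, z}"
    | "X' = {x, y, z}" by blast
  then show "(\<Sum>v\<in>P. dg m v X' - 1) < card X'"
    using single_sum pair_sum x sh triple by cases simp_all
qed (use P_N x P_independent mg in \<open>auto simp: mgraph_irrefl mgraph_sym[of m y x]
    mgraph_sym[of m z x] mgraph_sym[of m z y]\<close>)

text \<open>A vertex adjacent to all three counts 2 on the left and 3 on the right; one adjacent to
  exactly two counts 1 on both sides.\<close>

lemma triple_sum_le:
  assumes "x \<in> N" "y \<in> N" "z \<in> N" "x \<noteq> y" "x \<noteq> z" "y \<noteq> z"
  shows "(\<Sum>v\<in>P. dg m v {x, y, z} - 1) \<le> sh x y + sh x z + sh y z"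
  unfolding sh_def sum.distrib[symmetric]
proof (rule sum_mono)
  fix v assume "v \<in> P"
  then have "m v x \<le> 1" "m v y \<le> 1" "m v z \<le> 1" using mNP assms by auto
  then have "m v x \<in> {0, 1}" "m v y \<in> {0, 1}" "m v z \<in> {0, 1}" by auto
  then show "dg m v {x, y, z} - 1 \<le> m v x * m v y + m v x * m v z + m v y * m v z"
    using assms by (auto simp: dg_def)
qed

lemma N_dg:
  assumes "z \<in> N" "2 \<le> dg m z P"
  shows "w z = 0" "dg m z P + dg m z N = 4" "dg m z P \<le> 3"
  using N_types[OF assms(1)] assms(2) dg_V[of z] by auto

lemma dg_N_remove:
  assumes "x \<in> N"
  shows "dg m z N = m z x + dg m z (N - {x})"
  by (rule dg_remove[OF P_N(6) assms])

text \<open>Such an \<open>x\<close> takes at least 2 of the total excess 3, so at most one other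
  vertex \<open>y\<close> has excess, namely 1. Moving \<open>x\<close>, and \<open>y\<close> too if
  it still has two edges in the rest of \<open>N\<close>, closes no cycle, since \<open>x\<close>
  has at most one neighbour in \<open>P\<close>.\<close>

lemma no_low_excess:
  assumes x: "x \<in> N" "dg m x P \<le> 1"
  shows False
proof -
  have s3: "(3 - dg m x P) + (\<Sum>z\<in>N - {x}. 3 - dg m z P) = 3"
    using sum_excess sum.remove[OF P_N(6) x(1), of "\<lambda>z. 3 - dg m z P"] by simp
  then have s1: "(\<Sum>z\<in>N - {x}. 3 - dg m z P) \<le> 1" using x by linarith
  have z2: "2 \<le> dg m z P" if "z \<in> N - {x}" for z
    using member_le_sum[OF that, of "\<lambda>z. 3 - dg m z P"] P_N s1 by simp
  show False
  proof (cases "\<forall>z\<in>N - {x}. dg m z (N - {x}) \<le> 1")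
    case True
    show False
      by (rule recolour[of "{x}" "{}"])
        (use True x z2 N_dg forest_one[OF x(1)] in auto)
  next
    case False
    then obtain y where "y \<in> N - {x}" "\<not> dg m y (N - {x}) \<le> 1" by blast
    then have y: "y \<in> N" "y \<noteq> x" "2 \<le> dg m y (N - {x})" by auto
    have "2 \<le> dg m y N" using y dg_N_remove[OF x(1), of y] by simp
    then have y2: "dg m y P = 2" "dg m y N = 2" using N_dg[of y] z2[of y] y by auto
    then have yx: "m y x = 0" using y dg_N_remove[OF x(1), of y] by simp
    have "(\<Sum>z\<in>N - {x}. 3 - dg m z P) = (3 - dg m y P) + (\<Sum>z\<in>N - {x} - {y}. 3 - dg m z P)"
      using P_N y by (intro sum.remove) auto
    then have "(\<Sum>z\<in>N - {x} - {y}. 3 - dg m z P) = 0" using s1 y2 by simp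
    then have z3: "3 \<le> dg m z P" if "z \<in> N - {x, y}" for z
      using that P_N by (auto simp: Diff_insert2[symmetric])
    have "sh x y \<le> (\<Sum>v\<in>P. m v x)"
      unfolding sh_def using mNP y by (intro sum_mono) (metis mult.right_neutral mult_le_mono2)
    also have "\<dots> = dg m x P" unfolding dg_def by (rule sum.cong) (simp_all add: mgraph_sym[OF mg, of x])
    finally have "sh x y \<le> 1" using x by simp
    then have F: "forest_on m (P \<union> {x, y})"
      using x y yx mg by (intro forest_two) (auto simp: mgraph_sym[of m x y])
    show False
    proof (rule recolour[of "{x, y}" "{}"])
      fix z assume z: "z \<in> N - {x, y}"
      have "dg m z N = 1" using N_dg[of z] z3[OF z] z by auto
      then show "dg m z (N - {x, y}) \<le> 1" using dg_mono[OF P_N(6), of "N - {x, y}" m z] by auto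
      show "w z = 0" using N_dg[of z] z3[OF z] z by auto
    qed (use F x y in auto)
  qed
qed

section \<open>The three vertices with two edges inside \<open>N\<close>\<close>

lemma N_ge_2: "z \<in> N \<Longrightarrow> 2 \<le> dg m z P"
  using no_low_excess[of z] by force

definition T :: "'v set" where "T = {z \<in> N. dg m z P = 2}"

lemma N_T: "z \<in> N - T \<Longrightarrow> dg m z N = 1" "z \<in> T \<Longrightarrow> dg m z N = 2" "T \<subseteq> N"
  using N_dg[of z] N_ge_2[of z] by (auto simp: T_def)

lemma card_T: "card T = 3"
proof -
  have "(\<Sum>z\<in>N. 3 - dg m z P) = (\<Sum>z\<in>N. if z \<in> T then 1 else 0)"
  proof (rule sum.cong)
    fix z assume "z \<in> N"
    then show "3 - dg m z P = (if z \<in> T then 1 else 0)"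
      using N_dg[of z] N_ge_2[of z] by (auto simp: T_def)
  qed simp
  also have "\<dots> = card T" using P_N N_T by (simp add: sum.If_cases Int_absorb1)
  finally show ?thesis using sum_excess by simp
qed

text \<open>Outside \<open>T\<close> every vertex of \<open>N\<close> has a single edge in
  \<open>N\<close>. So the rest is a matching once each vertex of \<open>T\<close> is moved or loses
  an edge to a moved vertex.\<close>

lemma recolour_T:
  assumes X: "X \<subseteq> N" and T: "\<And>x. x \<in> T - X \<Longrightarrow> \<exists>y\<in>X. m x y \<noteq> 0"
    and F: "forest_on m (P \<union> X)"
  shows False
proof (rule recolour[of X "{}"])
  fix z assume z: "z \<in> N - X"
  show "w z = 0" using N_dg[of z] N_ge_2[of z] z by auto
  show "dg m z (N - X) \<le> 1"
  proof (cases "z \<in> T")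
    case True
    then obtain y where y: "y \<in> X" "m z y \<noteq> 0" using T z by blast
    have "dg m z (N - X) \<le> dg m z (N - {y})"
      using P_N y by (intro dg_mono) auto
    then show ?thesis using dg_N_remove[of y z] N_T(2)[OF True] X y by auto
  next
    case False
    then show ?thesis using N_T(1)[of z] z dg_mono[OF P_N(6), of "N - X" m z] by auto
  qed
qed (use X F in auto)

lemma obtain_P_neighbours:
  assumes "x \<in> T"
  obtains a b where "a \<in> P" "b \<in> P" "a \<noteq> b" "m a x = 1" "m b x = 1"
    "\<And>v. v \<in> P \<Longrightarrow> v \<noteq> a \<Longrightarrow> v \<noteq> b \<Longrightarrow> m v x = 0"
proof -
  have xN: "x \<in> N" using assms N_T by auto
  have "card {v \<in> P. m x v = 1} = 2" using assms dg_P_card[OF xN] by (simp add: T_def)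
  then obtain a b where ab: "{v \<in> P. m x v = 1} = {a, b}" "a \<noteq> b" by (auto simp: card_2_iff)
  have "a \<in> P" "b \<in> P" "m x a = 1" "m x b = 1" using ab(1) by blast+
  moreover have "m v x = 0" if "v \<in> P" "v \<noteq> a" "v \<noteq> b" for v
  proof -
    have "m x v \<noteq> 1" using ab that by blast
    moreover have "m x v \<le> 1" using mNP xN that by blast
    ultimately show ?thesis using mg by (simp add: mgraph_sym[of m v x])
  qed
  ultimately show ?thesis using that[of a b] ab mg by (simp add: mgraph_sym)
qed

lemma sh_eq:
  assumes "a \<in> P" "b \<in> P" "a \<noteq> b" "m a x = 1" "m b x = 1"
    "\<And>v. v \<in> P \<Longrightarrow> v \<noteq> a \<Longrightarrow> v \<noteq> b \<Longrightarrow> m v x = 0"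
  shows "sh x y = m a y + m b y"
proof -
  have "sh x y = (\<Sum>v\<in>{a, b}. m v x * m v y)"
    unfolding sh_def using assms P_N by (intro sum.mono_neutral_right) auto
  then show ?thesis using assms by simp
qed

text \<open>The component of \<open>x\<close> within \<open>N\<close> is a path \<open>u\<close>,
  \<open>x\<close>, \<open>u'\<close>. Moving an end relieves \<open>x\<close> as well as moving
  \<open>x\<close> itself does, which gives three candidates.\<close>

lemma obtain_ends:
  assumes x: "x \<in> T" and iso: "\<And>y. y \<in> T \<Longrightarrow> m x y = 0"
  obtains u u' where "u \<in> N - T" "u' \<in> N - T" "u \<noteq> u'" "m x u = 1" "m x u' = 1"
    "\<And>y. y \<in> N \<Longrightarrow> y \<noteq> x \<Longrightarrow> m u y = 0" "\<And>y. y \<in> N \<Longrightarrow> y \<noteq> x \<Longrightarrow> m u' y = 0"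
proof -
  have xN: "x \<in> N" using x N_T by auto
  have leaf: "m x u \<le> 1 \<and> (m x u = 1 \<longrightarrow> (\<forall>y\<in>N. y \<noteq> x \<longrightarrow> m u y = 0))" if "u \<in> N - T" for u
  proof -
    have "m u x + dg m u (N - {x}) = 1" using dg_N_remove[OF xN, of u] N_T(1)[OF that] by simp
    moreover have "m x u = m u x" using mg by (rule mgraph_sym)
    ultimately show ?thesis using P_N dg_eq_0[of "N - {x}" m u] by auto
  qed
  have d2: "dg m x N = 2" using N_T(2)[OF x] .
  then have "\<not> (\<forall>u\<in>N. m x u = 0)" using dg_eq_0[OF P_N(6), of m x] by simp
  then obtain u where u: "u \<in> N" "m x u \<noteq> 0" by blast
  then have uT: "u \<in> N - T" using iso by auto
  then have mu: "m x u = 1" using leaf u by force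
  have "dg m x (N - {u}) = 1" using dg_N_remove[OF u(1), of x] d2 mu by simp
  then have "\<not> (\<forall>y\<in>N - {u}. m x y = 0)" using dg_eq_0[of "N - {u}" m x] P_N by simp
  then obtain u' where u': "u' \<in> N" "u' \<noteq> u" "m x u' \<noteq> 0" by blast
  then have uT': "u' \<in> N - T" using iso by auto
  then have mu': "m x u' = 1" using leaf u' by force
  show ?thesis
    using that[of u u'] uT uT' mu mu' u' leaf by blast
qed

lemma P_sum_le:
  assumes "v \<in> P" "S \<subseteq> N"
  shows "(\<Sum>x\<in>S. m v x) \<le> 3"
  using dg_mono[OF P_N(6) assms(2), of m v] P_dg(2)[OF assms(1)] by (simp add: dg_def)

text \<open>Moving \<open>x1\<close> also relieves \<open>x2\<close>. The two neighbours of
  \<open>x1\<close> in \<open>P\<close> have four edges left, too few to hit each of the three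
  candidates for \<open>x3\<close> twice.\<close>

lemma one_adjacent_pair:
  assumes T: "T = {x1, x2, x3}" "x1 \<noteq> x2" "x1 \<noteq> x3" "x2 \<noteq> x3"
    and m12: "m x1 x2 \<noteq> 0" and m13: "m x1 x3 = 0" and m23: "m x2 x3 = 0"
  shows False
proof -
  have xN: "x1 \<in> N" "x2 \<in> N" "x3 \<in> N" using T N_T(3) by auto
  have x3: "x3 \<in> T" "\<And>y. y \<in> T \<Longrightarrow> m x3 y = 0"
    using T m13 m23 mg by (auto simp: mgraph_irrefl mgraph_sym[of m x3])
  obtain u u' where u: "u \<in> N - T" "u' \<in> N - T" "u \<noteq> u'" "m x3 u = 1" "m x3 u' = 1"
      "\<And>y. y \<in> N \<Longrightarrow> y \<noteq> x3 \<Longrightarrow> m u y = 0" "\<And>y. y \<in> N \<Longrightarrow> y \<noteq> x3 \<Longrightarrow> m u' y = 0"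
    using obtain_ends[OF x3] by blast
  have "x1 \<in> T" using T by simp
  then obtain a b where ab: "a \<in> P" "b \<in> P" "a \<noteq> b" "m a x1 = 1" "m b x1 = 1"
      "\<And>v. v \<in> P \<Longrightarrow> v \<noteq> a \<Longrightarrow> v \<noteq> b \<Longrightarrow> m v x1 = 0"
    using obtain_P_neighbours[OF \<open>x1 \<in> T\<close>] by blast
  have sh: "sh x1 y = m a y + m b y" for y by (rule sh_eq[OF ab])
  have dist: "u \<noteq> x1" "u \<noteq> x3" "u' \<noteq> x1" "u' \<noteq> x3" using u T by auto
  have sub: "{x1, x3, u, u'} \<subseteq> N" using xN u by auto
  have "m a x1 + m a x3 + m a u + m a u' \<le> 3" "m b x1 + m b x3 + m b u + m b u' \<le> 3"
    using P_sum_le[OF ab(1) sub] P_sum_le[OF ab(2) sub] dist T u(3) by simp_all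
  then have "sh x1 x3 \<le> 1 \<or> sh x1 u \<le> 1 \<or> sh x1 u' \<le> 1"
    unfolding sh using ab by linarith
  then obtain g where g: "g \<in> {x3, u, u'}" "sh x1 g \<le> 1" by blast
  have gN: "g \<in> N" "g \<noteq> x1" "m x1 g = 0"
    using g xN u dist T m13 mg by (auto simp: mgraph_sym[of m x1])
  show False
  proof (rule recolour_T[of "{x1, g}"])
    show "forest_on m (P \<union> {x1, g})" using gN xN g by (intro forest_two) auto
    fix x assume "x \<in> T - {x1, g}"
    then show "\<exists>y\<in>{x1, g}. m x y \<noteq> 0"
      using T g u m12 mg by (auto simp: mgraph_sym[of m x2 x1])
  qed (use gN xN in auto)
qed

text \<open>The neighbours \<open>s\<close>, \<open>a\<close>, \<open>b\<close> of
  \<open>x1\<close>, \<open>x2\<close> in \<open>P\<close> have \<open>1 + 2 + 2\<close> edges left,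
  so some candidate for \<open>x3\<close> takes at most one of them. The connections are then one at
  \<open>s\<close> and at most one more, within the two allowed.\<close>

lemma share_one:
  assumes T: "T = {x1, x2, x3}" "x1 \<noteq> x2" "x1 \<noteq> x3" "x2 \<noteq> x3"
    and iso: "\<And>x y. x \<in> T \<Longrightarrow> y \<in> T \<Longrightarrow> m x y = 0" and sh1: "sh x1 x2 = 1"
  shows False
proof -
  have xN: "x1 \<in> N" "x2 \<in> N" "x3 \<in> N" using T N_T(3) by auto
  have xT: "x1 \<in> T" "x2 \<in> T" "x3 \<in> T" using T by auto
  obtain u u' where u: "u \<in> N - T" "u' \<in> N - T" "u \<noteq> u'" "m x3 u = 1" "m x3 u' = 1"
      "\<And>y. y \<in> N \<Longrightarrow> y \<noteq> x3 \<Longrightarrow> m u y = 0" "\<And>y. y \<in> N \<Longrightarrow> y \<noteq> x3 \<Longrightarrow> m u' y = 0"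
    using obtain_ends[OF xT(3) iso[OF xT(3)]] by blast
  obtain a' b' where ab': "a' \<in> P" "b' \<in> P" "a' \<noteq> b'" "m a' x1 = 1" "m b' x1 = 1"
      "\<And>v. v \<in> P \<Longrightarrow> v \<noteq> a' \<Longrightarrow> v \<noteq> b' \<Longrightarrow> m v x1 = 0"
    using obtain_P_neighbours[OF xT(1)] by blast
  have "m a' x2 + m b' x2 = 1" using sh_eq[OF ab', of x2] sh1 by simp
  then obtain s a where sa: "s \<in> P" "a \<in> P" "s \<noteq> a" "m s x1 = 1" "m a x1 = 1"
      "\<And>v. v \<in> P \<Longrightarrow> v \<noteq> s \<Longrightarrow> v \<noteq> a \<Longrightarrow> m v x1 = 0" "m s x2 = 1" "m a x2 = 0"
  proof (cases "m a' x2 = 1")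
    case True
    then show ?thesis using that[of a' b'] ab' \<open>m a' x2 + m b' x2 = 1\<close> by auto
  next
    case False
    then show ?thesis using that[of b' a'] ab' \<open>m a' x2 + m b' x2 = 1\<close> by auto
  qed
  obtain c d where cd: "c \<in> P" "d \<in> P" "c \<noteq> d" "m c x2 = 1" "m d x2 = 1"
      "\<And>v. v \<in> P \<Longrightarrow> v \<noteq> c \<Longrightarrow> v \<noteq> d \<Longrightarrow> m v x2 = 0"
    using obtain_P_neighbours[OF xT(2)] by blast
  have "s = c \<or> s = d" using cd(6)[OF sa(1)] sa(7) by auto
  then obtain b where b: "b \<in> P" "b \<noteq> s" "m b x2 = 1"
      "\<And>v. v \<in> P \<Longrightarrow> v \<noteq> s \<Longrightarrow> v \<noteq> b \<Longrightarrow> m v x2 = 0"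
  proof (cases "s = c")
    case True
    then show ?thesis using that[of d] cd by auto
  next
    case False
    then show ?thesis using that[of c] cd \<open>s = c \<or> s = d\<close> by auto
  qed
  have ba: "b \<noteq> a" using b sa by auto
  have bx1: "m b x1 = 0" using sa b ba by simp
  have dist: "u \<noteq> x1" "u \<noteq> x2" "u \<noteq> x3" "u' \<noteq> x1" "u' \<noteq> x2" "u' \<noteq> x3" using u T by auto
  have sub: "{x1, x2, x3, u, u'} \<subseteq> N" using xN u by auto
  have le: "m v x1 + m v x2 + m v x3 + m v u + m v u' \<le> 3" if "v \<in> P" for v
    using P_sum_le[OF that sub] dist T u(3) by (simp add: add.assoc)
  have "m s x3 + m a x3 + m b x3 \<le> 1 \<or> m s u + m a u + m b u \<le> 1 \<or> m s u' + m a u' + m b u' \<le> 1"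
    using le[OF sa(1)] le[OF sa(2)] le[OF b(1)] sa b by linarith
  then obtain g where g: "g \<in> {x3, u, u'}" "m s g + m a g + m b g \<le> 1" by blast
  have gN: "g \<in> N" "g \<noteq> x1" "g \<noteq> x2" "m x1 g = 0" "m x2 g = 0"
    using g xN u dist T iso xT mg by (auto simp: mgraph_sym[of m x1] mgraph_sym[of m x2])
  have sh1g: "sh x1 g \<le> 1" using sh_eq[OF sa(1-6), of g] g by simp
  have sh2g: "sh x2 g \<le> 1" using sh_eq[OF sa(1) b(1) b(2)[symmetric] sa(7) b(3,4), of g] g by simp
  have "(\<Sum>v\<in>P. dg m v {x1, x2, g} - 1) = (\<Sum>v\<in>{s, a, b}. dg m v {x1, x2, g} - 1)"
  proof (rule sum.mono_neutral_right)
    show "\<forall>v\<in>P - {s, a, b}. dg m v {x1, x2, g} - 1 = 0"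
    proof
      fix v assume v: "v \<in> P - {s, a, b}"
      then have "m v x1 = 0" "m v x2 = 0" "m v g \<le> 1" using sa b mNP gN by auto
      then show "dg m v {x1, x2, g} - 1 = 0" using T gN by (auto simp: dg_def)
    qed
  qed (use P_N sa b in auto)
  also have "\<dots> \<le> 2"
    using sa b ba bx1 g(2) T gN by (auto simp: dg_def)
  finally have triple: "(\<Sum>v\<in>P. dg m v {x1, x2, g} - 1) \<le> 2" .
  show False
  proof (rule recolour_T[of "{x1, x2, g}"])
    show "forest_on m (P \<union> {x1, x2, g})"
      using gN xN T iso xT sh1 sh1g sh2g triple by (intro forest_three) auto
    fix x assume "x \<in> T - {x1, x2, g}"
    then show "\<exists>y\<in>{x1, x2, g}. m x y \<noteq> 0"
      using T g u by auto
  qed (use gN xN in auto)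
qed

text \<open>Moving both \<open>x1\<close> and \<open>x2\<close> would close a cycle through
  \<open>a\<close> and \<open>b\<close>, so one of them is replaced by an end of its path. The two
  edges left at \<open>a\<close>, \<open>b\<close> spoil at most one of the four ends, the four left
  at \<open>c\<close>, \<open>d\<close> at most two.\<close>

lemma share_two:
  assumes T: "T = {x1, x2, x3}" "x1 \<noteq> x2" "x1 \<noteq> x3" "x2 \<noteq> x3"
    and iso: "\<And>x y. x \<in> T \<Longrightarrow> y \<in> T \<Longrightarrow> m x y = 0"
    and sh: "sh x1 x2 = 2" "sh x1 x3 = 0" "sh x2 x3 = 0"
  shows False
proof -
  have xN: "x1 \<in> N" "x2 \<in> N" "x3 \<in> N" using T N_T(3) by auto
  have xT: "x1 \<in> T" "x2 \<in> T" "x3 \<in> T" using T by auto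
  obtain y y' where y: "y \<in> N - T" "y' \<in> N - T" "y \<noteq> y'" "m x1 y = 1" "m x1 y' = 1"
      "\<And>z. z \<in> N \<Longrightarrow> z \<noteq> x1 \<Longrightarrow> m y z = 0" "\<And>z. z \<in> N \<Longrightarrow> z \<noteq> x1 \<Longrightarrow> m y' z = 0"
    using obtain_ends[OF xT(1) iso[OF xT(1)]] by blast
  obtain u u' where u: "u \<in> N - T" "u' \<in> N - T" "u \<noteq> u'" "m x2 u = 1" "m x2 u' = 1"
      "\<And>z. z \<in> N \<Longrightarrow> z \<noteq> x2 \<Longrightarrow> m u z = 0" "\<And>z. z \<in> N \<Longrightarrow> z \<noteq> x2 \<Longrightarrow> m u' z = 0"
    using obtain_ends[OF xT(2) iso[OF xT(2)]] by blast
  obtain a b where ab: "a \<in> P" "b \<in> P" "a \<noteq> b" "m a x1 = 1" "m b x1 = 1"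
      "\<And>v. v \<in> P \<Longrightarrow> v \<noteq> a \<Longrightarrow> v \<noteq> b \<Longrightarrow> m v x1 = 0"
    using obtain_P_neighbours[OF xT(1)] by blast
  obtain c d where cd: "c \<in> P" "d \<in> P" "c \<noteq> d" "m c x3 = 1" "m d x3 = 1"
      "\<And>v. v \<in> P \<Longrightarrow> v \<noteq> c \<Longrightarrow> v \<noteq> d \<Longrightarrow> m v x3 = 0"
    using obtain_P_neighbours[OF xT(3)] by blast
  have sh1: "sh x1 z = m a z + m b z" for z by (rule sh_eq[OF ab])
  have sh3: "sh z x3 = m c z + m d z" for z using sh_eq[OF cd, of z] by (simp add: sh_sym)
  have x2: "m a x2 = 1" "m b x2 = 1"
    using sh1[of x2] sh mNP(2)[OF xN(2) ab(1)] mNP(2)[OF xN(2) ab(2)] by auto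
  have "sh x2 z = sh x1 z" for z
  proof -
    have "m v x2 = 0" if "v \<in> P" "v \<noteq> a" "v \<noteq> b" for v
    proof -
      have "sum (m x2) {a, b} + sum (m x2) (P - {a, b}) = dg m x2 P"
        unfolding dg_def using ab P_N by (subst sum.subset_diff[of "{a, b}" P]) auto
      then have "sum (m x2) (P - {a, b}) = 0"
        using x2 xT ab mg by (simp add: T_def mgraph_sym[of m x2])
      then show ?thesis using that P_N mg by (simp add: mgraph_sym[of m v])
    qed
    then show ?thesis using sh_eq[OF ab(1-3) x2, of z] sh1 by simp
  qed
  note sh2 = this
  have dist: "distinct [x1, x2, y, y', u, u']"
  proof -
    have "y \<noteq> u" "y \<noteq> u'" "y' \<noteq> u" "y' \<noteq> u'"
      using y(4,5) u(6,7)[OF xN(1)] T mg by (auto simp: mgraph_sym[of m x1])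
    then show ?thesis using y u T by auto
  qed
  have distc: "distinct [x3, y, y', u, u']" using dist y u T by auto
  have sub: "{x1, x2, y, y', u, u'} \<subseteq> N" "{x3, y, y', u, u'} \<subseteq> N" using xN y u by auto
  have le: "m v x1 + m v x2 + m v y + m v y' + m v u + m v u' \<le> 3"
      "m v x3 + m v y + m v y' + m v u + m v u' \<le> 3" if "v \<in> P" for v
    using P_sum_le[OF that sub(1)] P_sum_le[OF that sub(2)] dist distc by (simp_all add: add.assoc)
  have m1: "m v z \<le> 1" if "v \<in> P" "z \<in> {y, y', u, u'}" for v z
    using mNP(2) that y u by auto
  have "\<exists>g\<in>{y, y', u, u'}. m a g + m b g \<le> 1 \<and> m c g + m d g \<le> 1"
  proof (rule ccontr)
    assume "\<not> ?thesis"
    then have g: "m a g + m b g \<ge> 2 \<or> m c g + m d g \<ge> 2" if "g \<in> {y, y', u, u'}" for g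
      using that by fastforce
    have "m a y + m a y' + m a u + m a u' \<le> 1" "m b y + m b y' + m b u + m b u' \<le> 1"
      using le(1)[OF ab(1)] le(1)[OF ab(2)] ab x2 by simp_all
    moreover have "m c y + m c y' + m c u + m c u' \<le> 2" "m d y + m d y' + m d u + m d u' \<le> 2"
      using le(2)[OF cd(1)] le(2)[OF cd(2)] cd by simp_all
    ultimately show False
      using g[of y] g[of y'] g[of u] g[of u'] m1[OF ab(1)] m1[OF ab(2)] m1[OF cd(1)] m1[OF cd(2)]
      by simp linarith
  qed
  then obtain g where g: "g \<in> {y, y', u, u'}" "m a g + m b g \<le> 1" "m c g + m d g \<le> 1" by blast
  have "\<exists>x\<in>{x1, x2}. \<exists>x'\<in>{x1, x2}. x \<noteq> x' \<and> m x g = 0 \<and> m x' g \<noteq> 0"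
    using g(1) y u T xN mg by (auto simp: mgraph_sym[of m x1 u] mgraph_sym[of m x1 u']
        mgraph_sym[of m x2 y] mgraph_sym[of m x2 y'])
  then obtain x x' where x: "x \<in> {x1, x2}" "x' \<in> {x1, x2}" "x \<noteq> x'" "m x g = 0" "m x' g \<noteq> 0" by blast
  have gN: "g \<in> N" "g \<notin> T" "m x3 g = 0"
    using g(1) y u T xN mg by (auto simp: mgraph_sym[of m x3])
  have shs: "sh x x3 = 0" "sh x g \<le> 1" "sh x3 g \<le> 1"
    using x(1) sh sh1[of g] sh2[of g] sh3[of g] g sh_sym[of x3 g] by auto
  have x3: "x \<noteq> x3" "x \<in> T" "x \<in> N" using x T xT xN by auto
  have "g \<noteq> x" "g \<noteq> x3" using gN x3 xT by auto
  then have "(\<Sum>v\<in>P. dg m v {x, x3, g} - 1) \<le> 2"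
    using triple_sum_le[of x x3 g] shs x3 xN gN by auto
  then have F: "forest_on m (P \<union> {x, x3, g})"
    using shs x3 xN gN \<open>g \<noteq> x\<close> \<open>g \<noteq> x3\<close> x iso xT by (intro forest_three) auto
  show False
  proof (rule recolour_T[OF _ _ F])
    fix z assume "z \<in> T - {x, x3, g}"
    then have "z = x'" using T x by auto
    then show "\<exists>y\<in>{x, x3, g}. m z y \<noteq> 0" using x by auto
  qed (use gN xN x3 in auto)
qed

text \<open>All three edges of \<open>a\<close> go to \<open>T\<close>, so after moving
  \<open>T\<close> the vertex \<open>a\<close> is isolated on the other side and may change sides as
  well. Then only \<open>b\<close> connects vertices of \<open>T\<close>, as the centre of a
  star.\<close>

lemma share_all:
  assumes T: "T = {x1, x2, x3}" "x1 \<noteq> x2" "x1 \<noteq> x3" "x2 \<noteq> x3"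
    and iso: "\<And>x y. x \<in> T \<Longrightarrow> y \<in> T \<Longrightarrow> m x y = 0"
    and ab: "a \<in> P" "b \<in> P" "a \<noteq> b"
    and all: "\<And>x. x \<in> T \<Longrightarrow> m a x = 1"
    and none: "\<And>v x. x \<in> T \<Longrightarrow> v \<in> P \<Longrightarrow> v \<noteq> a \<Longrightarrow> v \<noteq> b \<Longrightarrow> m v x = 0"
  shows False
proof (rule recolour[of T "{a}"])
  show "forest_on m (P - {a} \<union> T)"
  proof (rule forest_on_bipartite[OF mg])
    fix X' assume X': "X' \<subseteq> T" "X' \<noteq> {}"
    have fX: "finite X'" using X'(1) N_T(3) P_N(6) by (meson finite_subset)
    have "(\<Sum>v\<in>P - {a}. dg m v X' - 1) = (\<Sum>v\<in>{b}. dg m v X' - 1)"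
    proof (rule sum.mono_neutral_right)
      show "\<forall>v\<in>P - {a} - {b}. dg m v X' - 1 = 0"
      proof
        fix v assume "v \<in> P - {a} - {b}"
        then have "dg m v X' = 0" using none X' fX by (auto simp: dg_eq_0)
        then show "dg m v X' - 1 = 0" by simp
      qed
    qed (use P_N ab in auto)
    also have "\<dots> = dg m b X' - 1" by simp
    also have "dg m b X' \<le> (\<Sum>x\<in>X'. 1)"
      unfolding dg_def using X' N_T(3) mNP(2) ab by (intro sum_mono) blast
    then have "dg m b X' - 1 < card X'" using X' fX card_gt_0_iff[of X'] by auto
    finally show "(\<Sum>v\<in>P - {a}. dg m v X' - 1) < card X'" .
  qed (use P_N N_T P_independent iso finite_subset in auto)
  show "dg m v (N - T) = 0" if "v \<in> {a}" for v
  proof -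
    have fT: "finite T" using N_T(3) P_N finite_subset by blast
    have "dg m a T = 3" using all T by (simp add: dg_def)
    moreover have "dg m a N = dg m a T + dg m a (N - T)"
      using dg_Un[OF fT, of "N - T" m a] P_N N_T(3) by (simp add: Un_absorb1)
    ultimately show ?thesis using P_dg(2)[OF ab(1)] that by simp
  qed
  show "dg m z (N - T) \<le> 1" if "z \<in> N - T" for z
    using N_T(1)[OF that] dg_mono[OF P_N(6), of "N - T" m z] by auto
  show "w z = 0" if "z \<in> N - T" for z using N_dg[of z] N_ge_2[of z] that by auto
qed (use N_T ab in auto)

lemma contradiction: False
proof -
  obtain x1 x2 x3 where T: "T = {x1, x2, x3}" "x1 \<noteq> x2" "x1 \<noteq> x3" "x2 \<noteq> x3"
    using card_T by (auto simp: card_3_iff)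
  have xT: "x1 \<in> T" "x2 \<in> T" "x3 \<in> T" using T by auto
  have xN: "x1 \<in> N" "x2 \<in> N" "x3 \<in> N" using T N_T(3) by auto
  have perm: "T = {x1, x3, x2}" "T = {x2, x3, x1}" using T by auto
  have two: False if "x \<in> T" "\<forall>y\<in>T - {x}. m x y \<noteq> 0" for x
    using that N_T(3) forest_one[of x] mg by (intro recolour_T[of "{x}"]) (auto simp: mgraph_sym[of m _ x])
  have sym: "m x2 x1 = m x1 x2" "m x3 x1 = m x1 x3" "m x3 x2 = m x2 x3"
    using mg mgraph_sym by metis+
  have "\<not> (m x1 x2 \<noteq> 0 \<and> m x1 x3 \<noteq> 0)" "\<not> (m x1 x2 \<noteq> 0 \<and> m x2 x3 \<noteq> 0)"
    "\<not> (m x1 x3 \<noteq> 0 \<and> m x2 x3 \<noteq> 0)"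
  proof -
    have d: "T - {x1} = {x2, x3}" "T - {x2} = {x1, x3}" "T - {x3} = {x1, x2}" using T by auto
    show "\<not> (m x1 x2 \<noteq> 0 \<and> m x1 x3 \<noteq> 0)" "\<not> (m x1 x2 \<noteq> 0 \<and> m x2 x3 \<noteq> 0)"
      "\<not> (m x1 x3 \<noteq> 0 \<and> m x2 x3 \<noteq> 0)"
      using two[OF xT(1), unfolded d] two[OF xT(2), unfolded d] two[OF xT(3), unfolded d]
      by (simp_all add: sym) (metis neq0_conv)+
  qed
  then have zero: "m x1 x2 = 0" "m x1 x3 = 0" "m x2 x3 = 0"
    using one_adjacent_pair[OF T] one_adjacent_pair[OF perm(1) T(3,2) T(4)[symmetric]]
      one_adjacent_pair[OF perm(2) T(4) T(2)[symmetric] T(3)[symmetric]] sym by auto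
  have iso: "m x y = 0" if "x \<in> T" "y \<in> T" for x y
    using that T zero sym mg by (auto simp: mgraph_irrefl)
  have ne1: "sh x1 x2 \<noteq> 1" "sh x1 x3 \<noteq> 1" "sh x2 x3 \<noteq> 1"
    using share_one[OF T iso] share_one[OF perm(1) T(3,2) T(4)[symmetric] iso]
      share_one[OF perm(2) T(4) T(2)[symmetric] T(3)[symmetric] iso] by auto
  \<comment> \<open>Two common neighbours mean equal neighbourhoods in \<open>P\<close>. This
    relation is transitive, which leaves the five patterns below.\<close>
  have same: "(sh x y = 0 \<or> sh x y = 2) \<and> (sh x y = 2 \<longrightarrow> (\<forall>v\<in>P. m v x = m v y))"
    if xy: "x \<in> T" "y \<in> T" "sh x y \<noteq> 1" for x y
  proof -
    have yN: "y \<in> N" using xy N_T(3) by auto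
    obtain a b where ab: "a \<in> P" "b \<in> P" "a \<noteq> b" "m a x = 1" "m b x = 1"
        "\<And>v. v \<in> P \<Longrightarrow> v \<noteq> a \<Longrightarrow> v \<noteq> b \<Longrightarrow> m v x = 0"
      using obtain_P_neighbours[OF xy(1)] by blast
    obtain c d where cd: "c \<in> P" "d \<in> P" "c \<noteq> d" "m c y = 1" "m d y = 1"
        "\<And>v. v \<in> P \<Longrightarrow> v \<noteq> c \<Longrightarrow> v \<noteq> d \<Longrightarrow> m v y = 0"
      using obtain_P_neighbours[OF xy(2)] by blast
    have eq: "sh x y = m a y + m b y" by (rule sh_eq[OF ab])
    have le: "m a y \<le> 1" "m b y \<le> 1" using mNP(2) yN ab by auto
    have "m v x = m v y" if "sh x y = 2" "v \<in> P" for v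
    proof -
      have "m a y = 1" "m b y = 1" using that eq le by auto
      then have "{a, b} = {c, d}" using cd(6)[OF ab(1)] cd(6)[OF ab(2)] ab(3) by auto
      then show ?thesis using ab cd that(2) by (metis doubleton_eq_iff)
    qed
    then show ?thesis using eq le xy(3) by auto
  qed
  note s12 = same[OF xT(1,2) ne1(1)] and s13 = same[OF xT(1,3) ne1(2)] and s23 = same[OF xT(2,3) ne1(3)]
  have cong: "sh x z = sh y z" if "\<forall>v\<in>P. m v x = m v y" for x y z
    using that by (simp add: sh_def)
  have s2: "sh x1 x2 = 2 \<longrightarrow> sh x1 x3 = sh x2 x3" "sh x1 x3 = 2 \<longrightarrow> sh x1 x2 = sh x2 x3"
      "sh x2 x3 = 2 \<longrightarrow> sh x1 x2 = sh x1 x3"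
    using cong[of x1 x2 x3] cong[of x1 x3 x2] cong[of x2 x3 x1] s12 s13 s23
    by (metis sh_sym)+
  consider "sh x1 x2 = 0" "sh x1 x3 = 0" "sh x2 x3 = 0" | "sh x1 x2 = 2" "sh x1 x3 = 2" "sh x2 x3 = 2"
    | "sh x1 x2 = 2" "sh x1 x3 = 0" "sh x2 x3 = 0" | "sh x1 x2 = 0" "sh x1 x3 = 2" "sh x2 x3 = 0"
    | "sh x1 x2 = 0" "sh x1 x3 = 0" "sh x2 x3 = 2"
    using s12[THEN conjunct1] s13[THEN conjunct1] s23[THEN conjunct1] s2 by fastforce
  then show False
  proof cases
    case 1
    have "forest_on m (P \<union> {x1, x2, x3})"
      using 1 triple_sum_le[OF xN T(2-4)] zero by (intro forest_three[OF xN T(2-4)]) auto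
    then show False
      using T xN by (intro recolour_T[of T]) auto
  next
    case 2
    obtain a b where ab: "a \<in> P" "b \<in> P" "a \<noteq> b" "m a x1 = 1" "m b x1 = 1"
        "\<And>v. v \<in> P \<Longrightarrow> v \<noteq> a \<Longrightarrow> v \<noteq> b \<Longrightarrow> m v x1 = 0"
      using obtain_P_neighbours[OF xT(1)] by blast
    have eq: "m v x = m v x1" if "x \<in> T" "v \<in> P" for v x
      using s12 s13 2 that T by auto
    show False
      by (rule share_all[OF T iso ab(1-3)]) (use eq ab in auto)
  next
    case 3
    then show False using share_two[OF T iso] by simp
  next
    case 4
    then show False using share_two[OF perm(1) T(3,2) T(4)[symmetric] iso] by (simp add: sh_sym)
  next
    case 5
    then show False
      using share_two[OF perm(2) T(4) T(2)[symmetric] T(3)[symmetric] iso] by (simp add: sh_sym)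
  qed
qed

end

theorem weighted_coloring:
  fixes m :: "'v \<Rightarrow> 'v \<Rightarrow> nat"
  assumes "1 \<le> D" "finite V" "mgraph m" "wsparse D m w V"
  shows "colorable D m w V"
  using assms(2-4)
proof (induction "card V" arbitrary: V m w rule: less_induct)
  case less
  show ?case
  proof (rule ccontr)
    assume "\<not> colorable D m w V"
    then interpret min_counterexample D m w V
      using less assms(1) by unfold_locales auto
    obtain h where "D = 2 * h + 1" using odd_D by (auto elim: oddE)
    then interpret odd_counterexample D m w V h by unfold_locales
    show False by (rule contradiction)
  qed
qed

section \<open>Back to multigraphs\<close>

definition mult :: "('v, 'e) multigraph \<Rightarrow> 'v \<Rightarrow> 'v \<Rightarrow> nat" where
  "mult G x y = (if x = y then 0 else card {e \<in> edges G. ends G e = {x, y}})"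

lemma mgraph_mult: "mgraph (mult G)"
  by (simp add: mgraph_def mult_def insert_commute)

lemma ne_mult:
  assumes G: "finite_multigraph G" "loopless G" and A: "finite A"
  shows "ne (mult G) A = card {e \<in> edges G. ends G e \<subseteq> A}"
  using A
proof (induction A)
  case empty
  have "{e \<in> edges G. ends G e \<subseteq> {}} = {}"
    using G by (auto simp: finite_multigraph_def)
  then show ?case by (simp only: card.empty ne_empty)
next
  case (insert v A)
  have fE: "finite (edges G)" using G by (simp add: finite_multigraph_def)
  let ?S = "\<lambda>y. {e \<in> edges G. ends G e = {v, y}}"
  have split: "{e \<in> edges G. ends G e \<subseteq> insert v A} = {e \<in> edges G. ends G e \<subseteq> A} \<union> (\<Union>y\<in>A. ?S y)"
  proof (intro equalityI subsetI)
    fix e assume e: "e \<in> {e \<in> edges G. ends G e \<subseteq> insert v A}"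
    then have "card (ends G e) = 2"
      using G by (auto simp: finite_multigraph_def loopless_def)
    then obtain x y where xy: "ends G e = {x, y}" "x \<noteq> y" by (auto simp: card_2_iff)
    then show "e \<in> {e \<in> edges G. ends G e \<subseteq> A} \<union> (\<Union>y\<in>A. ?S y)"
      using e by (cases "x = v"; cases "y = v") auto
  qed auto
  have "card (\<Union>y\<in>A. ?S y) = (\<Sum>y\<in>A. card (?S y))"
    using fE insert.hyps by (intro card_UN_disjoint) (auto simp: doubleton_eq_iff)
  also have "\<dots> = dg (mult G) v A"
    unfolding dg_def using insert.hyps by (intro sum.cong) (auto simp: mult_def)
  finally have "card (\<Union>y\<in>A. ?S y) = dg (mult G) v A" .
  moreover have "{e \<in> edges G. ends G e \<subseteq> A} \<inter> (\<Union>y\<in>A. ?S y) = {}"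
    using insert.hyps by auto
  ultimately have "card {e \<in> edges G. ends G e \<subseteq> insert v A}
      = card {e \<in> edges G. ends G e \<subseteq> A} + dg (mult G) v A"
    unfolding split using fE insert.hyps by (subst card_Un_disjoint) auto
  then show ?case
    using insert by (simp add: ne_insert[OF mgraph_mult])
qed

lemma edges_induced: "edges (induced_subgraph G A) = {e \<in> edges G. ends G e \<subseteq> A}"
  by (simp add: induced_subgraph_def)

text \<open>The vertex set of a cycle contains all its edges, as many as it has vertices.\<close>

lemma forest_induced:
  assumes G: "finite_multigraph G" "loopless G" and F: "F \<subseteq> verts G" "forest_on (mult G) F"
  shows "forest (induced_subgraph G F)"
  unfolding forest_def
proof
  assume "\<exists>vs es. is_cycle (induced_subgraph G F) vs es"
  then obtain vs es where c: "vs \<noteq> []" "length es = length vs" "distinct vs" "distinct es"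
      "set vs \<subseteq> F" "set es \<subseteq> {e \<in> edges G. ends G e \<subseteq> F}"
      "\<forall>i<length vs. ends G (es ! i) = {vs ! i, vs ! (Suc i mod length vs)}"
    unfolding is_cycle_def induced_subgraph_def by auto
  have "set es \<subseteq> {e \<in> edges G. ends G e \<subseteq> set vs}"
  proof
    fix e assume e: "e \<in> set es"
    then obtain i where i: "i < length vs" "e = es ! i" using c(2) by (metis in_set_conv_nth)
    have "Suc i mod length vs < length vs" using c(1) by simp
    then have "ends G e \<subseteq> set vs" using c(7) i by auto
    then show "e \<in> {e \<in> edges G. ends G e \<subseteq> set vs}" using c(6) e by auto
  qed
  then have "card (set es) \<le> card {e \<in> edges G. ends G e \<subseteq> set vs}"
    using G by (intro card_mono) (auto simp: finite_multigraph_def)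
  moreover have "card (set es) = card (set vs)" using c by (simp add: distinct_card)
  ultimately show False
    using forest_onD[OF F(2) c(5)] c(1) ne_mult[OF G, of "set vs"] by simp
qed

text \<open>Take a maximal set around \<open>v\<close> with at most one vertex more than edges. A
  further vertex joined to it would bring an edge along, so it is the whole component.\<close>

lemma connected_edges:
  assumes G: "finite_multigraph G" "loopless G" and M: "M \<subseteq> verts G" "v \<in> M"
    and U: "U = {u \<in> M. (v, u) \<in> (adjacency (induced_subgraph G M))\<^sup>*}"
  shows "card U \<le> Suc (ne (mult G) U)"
proof -
  let ?adj = "adjacency (induced_subgraph G M)"
  have fU: "finite U" using M U G finite_subset by (fastforce simp: finite_multigraph_def)
  define \<B> where "\<B> = {B. B \<subseteq> U \<and> v \<in> B \<and> card B \<le> Suc (ne (mult G) B)}"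
  have "finite \<B>" using fU by (simp add: \<B>_def)
  moreover have "{v} \<in> \<B>" using M U by (simp add: \<B>_def)
  ultimately obtain B where B: "B \<in> \<B>" "\<And>B'. B' \<in> \<B> \<Longrightarrow> B \<subseteq> B' \<Longrightarrow> B' = B"
    using finite_has_maximal2[of \<B> "{v}"] by metis
  have BU: "B \<subseteq> U" "v \<in> B" "finite B" "card B \<le> Suc (ne (mult G) B)"
    using B(1) fU finite_subset by (auto simp: \<B>_def)
  have "u \<in> B" if "(v, u) \<in> ?adj\<^sup>*" for u
    using that
  proof (induction rule: rtrancl_induct)
    case base
    then show ?case using BU by simp
  next
    case (step x y)
    obtain e where e: "e \<in> edges G" "ends G e = {x, y}" "{x, y} \<subseteq> M"
      using step(2) by (auto simp: adjacency_def induced_subgraph_def)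
    have yU: "y \<in> U" using U e step by (auto intro: rtrancl_into_rtrancl)
    show ?case
    proof (rule ccontr)
      assume y: "y \<notin> B"
      have "finite {e \<in> edges G. ends G e = {y, x}}" using G by (simp add: finite_multigraph_def)
      then have "0 < card {e \<in> edges G. ends G e = {y, x}}"
        using e by (auto simp: card_gt_0_iff insert_commute)
      then have "0 < mult G y x" using y step(3) by (auto simp: mult_def)
      then have "0 < dg (mult G) y B" using dg_ge[OF BU(3) step(3), of "mult G" y] by simp
      then have "insert y B \<in> \<B>"
        using BU y yU by (simp add: \<B>_def ne_insert[OF mgraph_mult])
      then show False using B(2)[of "insert y B"] y by blast
    qed
  qed
  then have "U = B" using U BU by blast
  then show ?thesis using BU by simp
qed

lemma colorable_DF_e:
  assumes G: "finite_multigraph G" "loopless G" and col: "colorable D (mult G) (\<lambda>_. 0) (verts G)"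
  shows "\<exists>M F. DF_e_coloring D G M F"
proof -
  obtain M F where MF: "M \<union> F = verts G" "M \<inter> F = {}" "bounded_forest_on D (mult G) (\<lambda>_. 0) M"
      "forest_on (mult G) F"
    using col unfolding colorable_def by blast
  have sub: "M \<subseteq> verts G" "F \<subseteq> verts G" using MF by auto
  have "card (edges C) \<le> D" if C: "C \<in> connected_components (induced_subgraph G M)" for C
  proof -
    obtain v U where v: "v \<in> M" and U: "U = {u \<in> M. (v, u) \<in> (adjacency (induced_subgraph G M))\<^sup>*}"
      and CU: "C = induced_subgraph (induced_subgraph G M) U"
      using C by (auto simp: connected_components_def induced_subgraph_def)
    have UM: "U \<subseteq> M" "v \<in> U" using U v by auto
    have fU: "finite U" using UM sub G finite_subset by (metis finite_multigraph_def)
    have "edges C = {e \<in> edges G. ends G e \<subseteq> U}"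
      using UM unfolding CU by (auto simp: induced_subgraph_def)
    then have eq: "card (edges C) = ne (mult G) U" using ne_mult[OF G fU] by simp
    have "ne (mult G) U < card U"
      using UM by (intro forest_onD[OF bounded_forest_on_forest[OF MF(3)]]) auto
    \<comment> \<open>Connectedness and acyclicity bound the edge number from both sides, so the
      component is one of the trees limited by \<open>D\<close>.\<close>
    then have "Suc (ne (mult G) U) = card U"
      using connected_edges[OF G sub(1) v U] by simp
    then show ?thesis
      using bounded_forest_on_tree[OF MF(3) UM(1)] eq by simp
  qed
  then have "DF_e_coloring D G M F"
    unfolding DF_e_coloring_def
    using MF forest_induced[OF G] sub bounded_forest_on_forest[OF MF(3)] by blast
  then show ?thesis by blast
qed

text \<open>Multiplied by \<open>kk D\<close>, the edge bound says that the potential is at least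
  -1, a vertex of weight 0 being worth \<open>2 * kk D - 1\<close>. Keeping \<open>a\<close> and
  \<open>b\<close> abstract treats both parities at once.\<close>

lemma sparse_wsparse:
  assumes G: "finite_multigraph G" and D: "1 \<le> D"
    and sparse: "sparse a b G" and a: "a * real_of_int (kk D) = 2 * real_of_int (kk D) - 1"
    and b: "b * real_of_int (kk D) = 1"
  shows "wsparse D (mult G) (\<lambda>_. 0) (verts G)"
proof (rule wsparseI[OF mgraph_mult])
  have ll: "loopless G" using sparse by (simp add: sparse_def)
  show fV: "finite (verts G)" using G by (simp add: finite_multigraph_def)
  fix A assume A: "A \<subseteq> verts G" "2 \<le> card A"
  have fA: "finite A" using A fV finite_subset by blast
  have "real (ne (mult G) A) \<le> a * real (card A) + b"
    using sparse A unfolding sparse_def edges_induced ne_mult[OF G ll fA] by blast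
  then have "real (ne (mult G) A) * real_of_int (kk D) \<le> (a * real (card A) + b) * real_of_int (kk D)"
    using kk_pos[of D] by (intro mult_right_mono) auto
  also have "\<dots> = (a * real_of_int (kk D)) * real (card A) + b * real_of_int (kk D)"
    by (simp add: algebra_simps)
  finally have "real_of_int (int (ne (mult G) A) * kk D)
      \<le> real_of_int ((2 * kk D - 1) * int (card A) + 1)"
    unfolding a b by simp
  then have "int (ne (mult G) A) * kk D \<le> (2 * kk D - 1) * int (card A) + 1"
    by (simp only: of_int_le_iff)
  moreover have "pw D 0 = 2 * kk D - 1" using D by (simp add: pw_def)
  ultimately show "-1 \<le> rho D (mult G) (\<lambda>_. 0) A"
    by (simp add: rho_def mult.commute)
qed

theorem theorem1p3:
  fixes G :: "('v, 'e) multigraph" and D :: nat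
  assumes "finite_multigraph G"
  shows "(odd D \<and> D \<ge> 1 \<and>
            sparse ((4 * real D + 3) / (2 * real D + 2)) (1 / (2 * (real D + 1))) G \<longrightarrow>
          (\<exists>M F. DF_e_coloring D G M F)) \<and>
         (even D \<and> D \<ge> 2 \<and>
            sparse ((4 * real D + 1) / (2 * real D + 1)) (1 / (2 * real D + 1)) G \<longrightarrow>
          (\<exists>M F. DF_e_coloring D G M F))"
proof -
  have main: "\<exists>M F. DF_e_coloring D G M F"
    if "1 \<le> D" "sparse a b G" "a * real_of_int (kk D) = 2 * real_of_int (kk D) - 1"
      "b * real_of_int (kk D) = 1" for a b
  proof -
    have "finite (verts G)" "loopless G"
      using assms that by (auto simp: finite_multigraph_def sparse_def)
    then show ?thesis
      using colorable_DF_e[OF assms] weighted_coloring[OF that(1) _ mgraph_mult]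
        sparse_wsparse[OF assms that] by blast
  qed
  show ?thesis
  proof (intro conjI impI; elim conjE)
    assume D: "odd D" "1 \<le> D"
      and sp: "sparse ((4 * real D + 3) / (2 * real D + 2)) (1 / (2 * (real D + 1))) G"
    show "\<exists>M F. DF_e_coloring D G M F"
      by (rule main[OF D(2) sp]) (use D in \<open>simp_all add: kk_def field_simps\<close>)
  next
    assume D: "even D" "2 \<le> D"
      and sp: "sparse ((4 * real D + 1) / (2 * real D + 1)) (1 / (2 * real D + 1)) G"
    show "\<exists>M F. DF_e_coloring D G M F"
      by (rule main[OF _ sp]) (use D in \<open>simp_all add: kk_def field_simps\<close>)
  qed
qed

end
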